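(* Let $X$ be a locally compact separable metric space endowed with its Borel $\sigma$-algebra, let $V$ be a finite-dimensional real vector space and let $|\cdot|_V$ be a strictly convex norm on $V$. Let $(\mu_n)_{n\in\mathbb{N}}$ be a sequence of Borel vector measures from $X$ to $V$ converging widely to a Borel vector measure $\mu$. If $\lim_{n\to\infty}|\mu_n|_V(X)=|\mu|_V(X)$, then $(\mathcal{R}(\mu_n))_{n\in\mathbb{N}}$ converges to $\mathcal{R}(\mu)$ in Hausdorff distance.
   Context: A norm $|\cdot|_V$ is strictly convex if for all linearly independent $v,w\in V$, $|v+w|_V<|v|_V+|w|_V$. A vector measure is a countably additive map $\mu:\Sigma\to V$. Total variation: $|\mu|_V(A)=\sup\{\sum_{i=1}^m|\mu(E_i)|_V : E_1,\dots,E_m\in\Sigma \text{ pairwise disjoint subsets of } A\}$. Range: $\mathcal{R}_A(\mu)=\overline{\mathrm{conv}}\{\mu(E):E\in\Sigma,E\subseteq A\}$, $\mathcal{R}(\mu)=\mathcal{R}_X(\mu)$. Wide convergence: $\int_X\varphi\,d\mu_n\to\int_X\varphi\,d\mu$ for every $\varphi\in C_c(X,\mathbb{R})$. *)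

theory Defs
  imports "HOL-Analysis.Analysis"
begin

definition strictly_convex_norm :: "'v::real_normed_vector itself \<Rightarrow> bool" where
  "strictly_convex_norm _ \<longleftrightarrow>
     (\<forall>v w::'v. v \<noteq> w \<and> independent {v, w} \<longrightarrow> norm (v + w) < norm v + norm w)"

definition finite_dim_space :: "'v::real_vector itself \<Rightarrow> bool" where
  "finite_dim_space _ \<longleftrightarrow> (\<exists>B::'v set. finite B \<and> span B = UNIV)"

definition separable_space :: "'a::topological_space itself \<Rightarrow> bool" where
  "separable_space _ \<longleftrightarrow> (\<exists>D::'a set. countable D \<and> closure D = UNIV)"

text \<open>A Borel vector measure: a countably additive map from the Borel sets to V
  (values on non-Borel sets are irrelevant).\<close>
definition borel_vector_measure :: "('a::topological_space set \<Rightarrow> 'v::real_normed_vector) \<Rightarrow> bool" where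
  "borel_vector_measure \<mu> \<longleftrightarrow>
     (\<forall>A::nat \<Rightarrow> 'a set. range A \<subseteq> sets borel \<longrightarrow> disjoint_family A \<longrightarrow>
        (\<lambda>n. \<mu> (A n)) sums \<mu> (\<Union>n. A n))"

definition total_variation :: "('a::topological_space set \<Rightarrow> 'v::real_normed_vector) \<Rightarrow> 'a set \<Rightarrow> real" where
  "total_variation \<mu> A = Sup {(\<Sum>i<m. norm (\<mu> (E i))) | (m::nat) E.
      (\<forall>i<m. E i \<in> sets borel \<and> E i \<subseteq> A) \<and> disjoint_family_on E {..<m}}"

definition vm_range :: "('a::topological_space set \<Rightarrow> 'v::real_normed_vector) \<Rightarrow> 'v set" where
  "vm_range \<mu> = closure (convex hull {\<mu> E | E. E \<in> sets borel})"

text \<open>Hausdorff distance between (bounded, nonempty) subsets of a metric space.\<close>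
definition hausdorff_distance :: "'v::metric_space set \<Rightarrow> 'v set \<Rightarrow> real" where
  "hausdorff_distance A B = max (SUP a\<in>A. infdist a B) (SUP b\<in>B. infdist b A)"

definition pos_variation :: "('a::topological_space set \<Rightarrow> real) \<Rightarrow> 'a set \<Rightarrow> real" where
  "pos_variation \<nu> A = Sup {\<nu> B | B. B \<in> sets borel \<and> B \<subseteq> A}"

definition jordan_pos :: "('a::topological_space set \<Rightarrow> real) \<Rightarrow> 'a measure" where
  "jordan_pos \<nu> = measure_of UNIV (sets borel) (\<lambda>A. ennreal (pos_variation \<nu> A))"

definition jordan_neg :: "('a::topological_space set \<Rightarrow> real) \<Rightarrow> 'a measure" where
  "jordan_neg \<nu> = measure_of UNIV (sets borel) (\<lambda>A. ennreal (pos_variation (\<lambda>B. - \<nu> B) A))"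

definition signed_integral :: "('a::topological_space set \<Rightarrow> real) \<Rightarrow> ('a \<Rightarrow> real) \<Rightarrow> real" where
  "signed_integral \<nu> \<phi> = (\<integral>x. \<phi> x \<partial>jordan_pos \<nu>) - (\<integral>x. \<phi> x \<partial>jordan_neg \<nu>)"

definition vm_integral :: "('a::topological_space set \<Rightarrow> 'v::real_normed_vector) \<Rightarrow> ('a \<Rightarrow> real) \<Rightarrow> 'v" where
  "vm_integral \<mu> \<phi> = (THE v. \<forall>l::'v \<Rightarrow> real. linear l \<longrightarrow> l v = signed_integral (\<lambda>A. l (\<mu> A)) \<phi>)"

definition Cc :: "('a::topological_space \<Rightarrow> real) set" where
  "Cc = {\<phi>. continuous_on UNIV \<phi> \<and> compact (closure {x. \<phi> x \<noteq> 0})}"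

definition widely_converges :: "(nat \<Rightarrow> 'a::topological_space set \<Rightarrow> 'v::real_normed_vector) \<Rightarrow> ('a set \<Rightarrow> 'v) \<Rightarrow> bool" where
  "widely_converges \<mu>s \<mu> \<longleftrightarrow> (\<forall>\<phi>\<in>Cc. (\<lambda>n. vm_integral (\<mu>s n) \<phi>) \<longlonglongrightarrow> vm_integral \<mu> \<phi>)"

end

theory Submission
  imports Defs
begin

text \<open>
  Choose \<open>\<phi>\<^sub>1, \<dots>, \<phi>\<^sub>m \<ge> 0\<close> in \<open>C\<^sub>c\<close> with sum at most 1 such that
  \<open>\<Sum>\<^sub>i |\<integral>\<phi>\<^sub>i d\<mu>|\<close> is almost \<open>|\<mu>|(X)\<close>. For large \<open>n\<close>, wide convergence and convergence of the
  total variations make \<open>\<Sum>\<^sub>i |\<integral>\<phi>\<^sub>i d\<mu>\<^sub>n|\<close> almost \<open>|\<mu>\<^sub>n|(X)\<close>. For a Borel set \<open>E\<close>, split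
  \<open>\<integral>\<phi>\<^sub>i d\<mu>\<^sub>n\<close> as \<open>v\<^sub>i + w\<^sub>i\<close>, the integrals over \<open>E\<close> and over its complement. The deficits
  \<open>|v\<^sub>i| + |w\<^sub>i| - |v\<^sub>i + w\<^sub>i|\<close> then have a small sum, so by strict convexity each \<open>v\<^sub>i\<close> is close to
  \<open>t\<^sub>i (v\<^sub>i + w\<^sub>i)\<close> for some \<open>t\<^sub>i\<close> in \<open>[0,1]\<close>. Hence \<open>\<mu>\<^sub>n(E)\<close> is close to
  \<open>\<integral>(\<Sum>\<^sub>i t\<^sub>i \<phi>\<^sub>i) d\<mu>\<close>, a point of the range of \<open>\<mu>\<close>, uniformly in \<open>E\<close>. Conversely the points
  \<open>\<integral>\<phi> d\<mu>\<close> with \<open>\<phi>\<close> in \<open>C\<^sub>c\<close> and \<open>0 \<le> \<phi> \<le> 1\<close> are dense in the compact range of \<open>\<mu>\<close>,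
  and they are limits of points of the ranges of the \<open>\<mu>\<^sub>n\<close>.
\<close>

section \<open>Finite-dimensional normed spaces\<close>

text \<open>Strict convexity gives one strict inequality per pair of vectors, whereas the deficits
  must be controlled for all Borel sets and all large \<open>n\<close> at once. Compactness of the
  unit sphere turns it into an estimate that is linear in the norms and in the deficit, with a
  constant \<open>C\<close> depending on the tolerance \<open>\<delta>\<close> alone, so that it can
  be added over any number of pieces. Hence the order of choices: \<open>\<delta>\<close>, then
  \<open>C\<close>, then \<open>\<epsilon>\<close>, and only then the test functions. Convergence of
  the total variations prevents mass from escaping to infinity: whatever the test functions miss is
  one more nonnegative function competing for the same total variation. Neither a polar
  decomposition of \<open>\<mu>\<close> nor a variation measure is constructed. The integral is used
  through the properties collected in \<open>represents\<close>, inequalities between integrals and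
  values on sets come from averaging over level sets, and a finite positive measure dominating
  \<open>\<mu>\<close> up to a constant serves for approximation in L1.\<close>

lemma closed_if_bounded_seq:
  fixes S :: "'v::metric_space set"
  assumes "\<And>x. (\<And>n. x n \<in> S) \<Longrightarrow> bounded (range x) \<Longrightarrow> \<exists>l\<in>S. \<exists>r::nat\<Rightarrow>nat. strict_mono r \<and> (x \<circ> r) \<longlonglongrightarrow> l"
  shows "closed S"
  unfolding closed_sequential_limits
proof safe
  fix y l assume y: "\<forall>n. y n \<in> S" "y \<longlonglongrightarrow> l"
  have "bounded (range y)" using y convergent_imp_bounded by blast
  with assms[of y] y(1) obtain l' r where l': "l' \<in> S" "strict_mono r" "(y \<circ> r) \<longlonglongrightarrow> l'"
    by blast
  then have "l = l'" using LIMSEQ_subseq_LIMSEQ[OF y(2) l'(2)] LIMSEQ_unique by blast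
  then show "l \<in> S" using l' by simp
qed

text \<open>Bolzano-Weierstrass, by induction on the spanning set. The induction hypothesis also
  makes \<open>span B\<close> closed, so a new vector \<open>b\<close> outside it has positive
  distance from it; this distance bounds the coefficients of \<open>b\<close> along a bounded
  sequence, and subsequences can be extracted first for the coefficients and then for the
  remainder.\<close>

lemma finite_span_bounded_seq:
  fixes B :: "'v::real_normed_vector set"
  assumes "finite B" "\<And>n. x n \<in> span B" "bounded (range x)"
  shows "\<exists>l\<in>span B. \<exists>r::nat\<Rightarrow>nat. strict_mono r \<and> (x \<circ> r) \<longlonglongrightarrow> l"
  using assms
proof (induction B arbitrary: x rule: finite_induct)
  case empty
  then have "x = (\<lambda>n. 0)" by auto
  then show ?case using strict_mono_id by (auto simp: o_def)
next
  case (insert b B)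
  show ?case
  proof (cases "b \<in> span B")
    case True
    then have "span (insert b B) = span B" by (rule span_redundant)
    then show ?thesis using insert by auto
  next
    case False
    have "closed (span B)" using insert.IH by (rule closed_if_bounded_seq)
    moreover have "span B \<noteq> {}" using span_zero by blast
    ultimately have pos: "infdist b (span B) > 0"
      using False infdist_pos_not_in_closed by blast
    let ?d = "infdist b (span B)"
    have "\<exists>k. x n - k *\<^sub>R b \<in> span B" for n
      using insert.prems(1)[of n] by (simp add: span_insert)
    then obtain k where k: "\<And>n. x n - k n *\<^sub>R b \<in> span B" by metis
    \<comment> \<open>Rescaling the component in \<open>span B\<close> by \<open>- 1 / k n\<close>
      gives a point of \<open>span B\<close> whose difference from \<open>b\<close> is
      \<open>x n\<close> divided by \<open>k n\<close>.\<close>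
    have kb: "\<bar>k n\<bar> * ?d \<le> norm (x n)" for n
    proof (cases "k n = 0")
      case False
      have "(- 1 / k n) *\<^sub>R (x n - k n *\<^sub>R b) \<in> span B" using k span_scale by blast
      then have "?d \<le> dist b ((- 1 / k n) *\<^sub>R (x n - k n *\<^sub>R b))"
        by (rule infdist_le)
      also have "\<dots> = norm ((1 / k n) *\<^sub>R x n)"
        using False by (simp add: dist_norm algebra_simps)
      also have "\<dots> = norm (x n) / \<bar>k n\<bar>" by simp
      finally show ?thesis using False by (simp add: field_simps)
    qed auto
    obtain M where M: "\<And>n. norm (x n) \<le> M"
      using insert.prems(2) by (auto simp: bounded_iff)
    have kM: "\<bar>k n\<bar> \<le> M / ?d" for n
      using kb[of n] M[of n] pos by (simp add: pos_le_divide_eq)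
    then have "bounded (range k)" by (auto simp: bounded_iff)
    then obtain k0 r where r: "strict_mono r" "(k \<circ> r) \<longlonglongrightarrow> k0"
      using bounded_imp_convergent_subsequence by blast
    define y where "y = (\<lambda>n. x (r n) - k (r n) *\<^sub>R b)"
    have "norm (y n) \<le> M + M / ?d * norm b" for n
      using norm_triangle_ineq4[of "x (r n)" "k (r n) *\<^sub>R b"] M[of "r n"]
        mult_right_mono[OF kM[of "r n"], of "norm b"] by (simp add: y_def)
    then have "bounded (range y)" by (auto simp: bounded_iff)
    moreover have "\<And>n. y n \<in> span B" by (simp add: y_def k)
    ultimately obtain l q where q: "l \<in> span B" "strict_mono q" "(y \<circ> q) \<longlonglongrightarrow> l"
      using insert.IH[of y] by blast
    have "(\<lambda>n. (y \<circ> q) n + ((k \<circ> r) \<circ> q) n *\<^sub>R b) \<longlonglongrightarrow> l + k0 *\<^sub>R b"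
      by (intro tendsto_intros q LIMSEQ_subseq_LIMSEQ r)
    moreover have "(\<lambda>n. (y \<circ> q) n + ((k \<circ> r) \<circ> q) n *\<^sub>R b) = x \<circ> (r \<circ> q)"
      by (simp add: y_def fun_eq_iff)
    moreover have "l + k0 *\<^sub>R b \<in> span (insert b B)"
      by (intro span_add span_scale subsetD[OF span_mono[of B] q(1)] span_base) auto
    ultimately show ?thesis
      using strict_mono_o[OF r(1) q(2)] by (intro bexI exI[of _ "r \<circ> q"] conjI) (simp_all only:)
  qed
qed

lemma closed_span_finite:
  "finite B \<Longrightarrow> closed (span (B :: 'v::real_normed_vector set))"
  by (rule closed_if_bounded_seq) (rule finite_span_bounded_seq)

lemma finite_dim_compact:
  fixes S :: "'v::real_normed_vector set"
  assumes "finite_dim_space TYPE('v)" "bounded S" "closed S"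
  shows "compact S"
  unfolding compact_eq_seq_compact_metric seq_compact_def
proof safe
  fix f :: "nat \<Rightarrow> 'v" assume f: "\<forall>n. f n \<in> S"
  obtain B :: "'v set" where B: "finite B" "span B = UNIV"
    using assms(1) by (auto simp: finite_dim_space_def)
  have "bounded (range f)" using assms(2) f by (blast intro: bounded_subset)
  then obtain l r where l: "strict_mono r" "(f \<circ> r) \<longlonglongrightarrow> l"
    using finite_span_bounded_seq[OF B(1), of f] B(2) by auto
  moreover have "l \<in> S"
    using closed_sequentially[OF assms(3) _ l(2)] f by simp
  ultimately show "\<exists>l\<in>S. \<exists>r. strict_mono r \<and> (f \<circ> r) \<longlonglongrightarrow> l"
    by blast
qed

lemma finite_dim_closed_subspace:
  fixes S :: "'v::real_normed_vector set"
  assumes "finite_dim_space TYPE('v)" "subspace S"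
  shows "closed S"
proof -
  obtain T :: "'v set" where T: "finite T" "span T = UNIV"
    using assms(1) by (auto simp: finite_dim_space_def)
  obtain B where B: "B \<subseteq> S" "independent B" "S \<subseteq> span B"
    by (rule maximal_independent_subset)
  have "finite B" using independent_span_bound[OF T(1) B(2)] T(2) by auto
  moreover have "span B = S" using B assms(2) span_minimal by blast
  ultimately show ?thesis using closed_span_finite[of B] by simp
qed

text \<open>The kernel is a closed subspace, so a vector \<open>a\<close> with
  \<open>l a \<noteq> 0\<close> has positive distance from it. If \<open>l x \<noteq> 0\<close>,
  subtracting \<open>(l a / l x) *\<^sub>R x\<close> from \<open>a\<close> lands in the kernel,
  which bounds \<open>l x\<close> by that distance.\<close>

lemma finite_dim_bounded_linear:
  fixes l :: "'v::real_normed_vector \<Rightarrow> real"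
  assumes "finite_dim_space TYPE('v)" "linear l"
  shows "bounded_linear l"
proof (cases "\<forall>x. l x = 0")
  case True
  then have "l = (\<lambda>x. 0)" by auto
  then show ?thesis by simp
next
  case False
  then obtain a where a: "l a \<noteq> 0" by blast
  let ?K = "{x. l x = 0}"
  have K: "closed ?K"
    using finite_dim_closed_subspace[OF assms(1)] linear_subspace_kernel[OF assms(2)] by simp
  have "0 \<in> ?K" using assms(2) by (simp add: linear_0)
  then have d: "infdist a ?K > 0"
    using infdist_pos_not_in_closed[OF K, of a] a by blast
  have "\<bar>l x\<bar> \<le> norm x * (\<bar>l a\<bar> / infdist a ?K)" for x
  proof (cases "l x = 0")
    case False
    have "a - (l a / l x) *\<^sub>R x \<in> ?K"
      using False by (simp add: linear_diff[OF assms(2)] linear_scale[OF assms(2)])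
    then have "infdist a ?K \<le> norm ((l a / l x) *\<^sub>R x)"
      by (metis infdist_le dist_norm diff_diff_eq2 add_diff_cancel_left')
    then show ?thesis using False d by (simp add: field_simps)
  qed (use d in simp)
  then show ?thesis
    using assms(2) by (intro bounded_linear_intro[where K="\<bar>l a\<bar> / infdist a ?K"])
      (auto simp: linear_add linear_scale)
qed

text \<open>On the compact set of pairs of unit vectors at distance at least \<open>\<delta>\<close>
  the norm of the sum attains its maximum; strict convexity makes this maximum smaller than
  2.\<close>

lemma uniformly_convex:
  assumes fd: "finite_dim_space TYPE('v::real_normed_vector)"
    and sc: "strictly_convex_norm TYPE('v)" and "\<delta> > 0"
  shows "\<exists>\<eta>>0. \<forall>u v::'v. norm u = 1 \<longrightarrow> norm v = 1 \<longrightarrow> \<delta> \<le> norm (u - v) \<longrightarrow> norm (u + v) \<le> 2 - \<eta>"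
proof -
  have "compact (sphere (0::'v) 1)" proof (rule finite_dim_compact[OF fd])
    show "bounded (sphere (0::'v) 1)" by (auto simp: bounded_iff intro!: exI[of _ 1])
    show "closed (sphere (0::'v) 1)"
      unfolding sphere_def by (intro closed_Collect_eq continuous_intros)
  qed
  then have "compact (sphere (0::'v) 1 \<times> sphere (0::'v) 1)" by (intro compact_Times)
  moreover have "closed {p::'v \<times> 'v. \<delta> \<le> norm (fst p - snd p)}"
    by (intro closed_Collect_le continuous_intros)
  ultimately have C: "compact (sphere (0::'v) 1 \<times> sphere (0::'v) 1 \<inter> {p. \<delta> \<le> norm (fst p - snd p)})"
    (is "compact ?C") by (rule compact_Int_closed)
  show ?thesis
  proof (cases "?C = {}")
    case True
    have "\<not> \<delta> \<le> norm (u - v)" if "norm u = 1" "norm v = 1" for u v :: 'v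
    proof
      assume "\<delta> \<le> norm (u - v)"
      then have "(u, v) \<in> ?C" using that by simp
      then show False using True by blast
    qed
    then show ?thesis by (intro exI[of _ 1]) simp
  next
    case False
    have "continuous_on ?C (\<lambda>p. norm (fst p + snd p))" by (intro continuous_intros)
    from continuous_attains_sup[OF C False this]
    obtain p where p: "p \<in> ?C" "\<forall>q\<in>?C. norm (fst q + snd q) \<le> norm (fst p + snd p)"
      by blast
    define u v where "u = fst p" and "v = snd p"
    have uv: "norm u = 1" "norm v = 1" "\<delta> \<le> norm (u - v)"
      using p(1) by (auto simp: u_def v_def)
    have max: "norm (x + y) \<le> norm (u + v)"
      if "norm x = 1" "norm y = 1" "\<delta> \<le> norm (x - y)" for x y :: 'v
      using p(2)[rule_format, of "(x, y)"] that by (simp add: u_def v_def)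
    have ne: "u \<noteq> v" using uv \<open>\<delta> > 0\<close> by auto
    have "norm (u + v) < 2"
    proof (cases "independent {u, v}")
      case True
      then have "norm (u + v) < norm u + norm v" using sc ne unfolding strictly_convex_norm_def by blast
      then show ?thesis using uv by simp
    next
      \<comment> \<open>Strict convexity speaks only of independent pairs. Dependent unit vectors
        are equal or opposite; equality is excluded by \<open>\<delta> > 0\<close>, and opposite
        vectors have sum 0.\<close>
      case False
      have "v \<noteq> 0" "u \<noteq> 0" using uv by auto
      have "u \<in> span {v}"
        using False \<open>v \<noteq> 0\<close> ne by (simp add: independent_insert)
      then obtain k where k: "u = k *\<^sub>R v" by (auto simp: span_singleton)
      then have "\<bar>k\<bar> = 1" using uv by simp
      then have "k = 1 \<or> k = -1" by auto
      then have "u = - v" using k ne by auto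
      then show ?thesis by simp
    qed
    then show ?thesis using max by (intro exI[of _ "2 - norm (u + v)"]) auto
  qed
qed

text \<open>Either the directions of \<open>v\<close> and \<open>w\<close> differ by less than
  \<open>\<delta>\<close>, which the first term pays for, or uniform convexity makes the deficit
  comparable to the smaller of the two norms, which the second term pays for. Both terms are
  additive, so the estimate can be summed over many pairs.\<close>

lemma norm_deficit_alignment:
  assumes "finite_dim_space TYPE('v::real_normed_vector)" "strictly_convex_norm TYPE('v)" "\<delta> > 0"
  shows "\<exists>C\<ge>0. \<forall>v w::'v. \<exists>t\<in>{0..1}. norm (v - t *\<^sub>R (v + w)) \<le>
      \<delta> * (norm v + norm w) + C * (norm v + norm w - norm (v + w))"
proof -
  obtain \<eta> where \<eta>: "\<eta> > 0"
    "\<And>u v::'v. norm u = 1 \<Longrightarrow> norm v = 1 \<Longrightarrow> \<delta> \<le> norm (u - v) \<Longrightarrow> norm (u + v) \<le> 2 - \<eta>"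
    using uniformly_convex[OF assms] by blast
  have "\<exists>t\<in>{0..1}. norm (v - t *\<^sub>R (v + w)) \<le>
      \<delta> * (norm v + norm w) + 2 / \<eta> * (norm v + norm w - norm (v + w))" for v w :: 'v
  proof (cases "v = 0 \<or> w = 0")
    case True
    then show ?thesis
    proof
      assume "v = 0"
      then show ?thesis using assms(3) by (intro bexI[of _ 0]) auto
    next
      assume "w = 0"
      then show ?thesis using assms(3) by (intro bexI[of _ 1]) auto
    qed
  next
    case False
    define a b where "a = norm v" and "b = norm w"
    have ab: "a > 0" "b > 0" using False by (auto simp: a_def b_def)
    define x y where "x = v /\<^sub>R a" and "y = w /\<^sub>R b"
    have xy: "norm x = 1" "norm y = 1" "v = a *\<^sub>R x" "w = b *\<^sub>R y"
      using ab by (auto simp: x_def y_def a_def b_def)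
    define D where "D = a + b - norm (v + w)"
    have D0: "D \<ge> 0" using norm_triangle_ineq[of v w] by (simp add: D_def a_def b_def)
    \<comment> \<open>The witness \<open>t = a / (a + b)\<close> is the one that would be exact for
      parallel \<open>v\<close> and \<open>w\<close>; the error is the difference of the directions
      with a factor of at most \<open>min a b\<close>.\<close>
    have "v - (a / (a + b)) *\<^sub>R (v + w) = (a * b / (a + b)) *\<^sub>R (x - y)"
    proof -
      have "a - a / (a + b) * a = a * b / (a + b)" "a / (a + b) * b = a * b / (a + b)"
        using ab by (auto simp: field_simps)
      then show ?thesis
        by (simp add: xy(3,4) scaleR_add_right scaleR_diff_right flip: scaleR_diff_left diff_diff_eq)
    qed
    then have nrm: "norm (v - (a / (a + b)) *\<^sub>R (v + w)) = a * b / (a + b) * norm (x - y)"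
      using ab by simp
    have le_min: "a * b / (a + b) \<le> min a b"
      using ab by (auto simp: field_simps min_def)
    have "a * b / (a + b) * norm (x - y) \<le> \<delta> * (a + b) + 2 / \<eta> * D"
    proof (cases "norm (x - y) < \<delta>")
      case True
      have "a * b / (a + b) * norm (x - y) \<le> (a + b) * \<delta>"
        using True le_min ab by (intro mult_mono) auto
      moreover have "2 / \<eta> * D \<ge> 0" using D0 \<eta>(1) by simp
      ultimately show ?thesis by (simp add: mult.commute)
    next
      case False
      then have s: "norm (x + y) \<le> 2 - \<eta>" using \<eta>(2) xy by simp
      \<comment> \<open>Equal amounts \<open>min a b\<close> of both directions are paired off and
        lose \<open>\<eta>\<close> per unit; the excess of the longer vector is handled by the
        triangle inequality.\<close>
      have "norm (v + w) \<le> a + b - \<eta> * min a b"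
      proof (cases "a \<le> b")
        case True
        have "v + w = a *\<^sub>R (x + y) + (b - a) *\<^sub>R y"
          by (simp add: xy(3,4) algebra_simps)
        then have "norm (v + w) \<le> a * norm (x + y) + (b - a)"
          using norm_triangle_ineq[of "a *\<^sub>R (x + y)" "(b - a) *\<^sub>R y"] True ab xy(2) by simp
        also have "\<dots> \<le> a * (2 - \<eta>) + (b - a)" using s ab by simp
        finally show ?thesis using True by (simp add: algebra_simps)
      next
        case False
        have "v + w = b *\<^sub>R (x + y) + (a - b) *\<^sub>R x"
          by (simp add: xy(3,4) algebra_simps)
        then have "norm (v + w) \<le> b * norm (x + y) + (a - b)"
          using norm_triangle_ineq[of "b *\<^sub>R (x + y)" "(a - b) *\<^sub>R x"] False ab xy(1) by simp
        also have "\<dots> \<le> b * (2 - \<eta>) + (a - b)" using s ab by simp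
        finally show ?thesis using False by (simp add: algebra_simps)
      qed
      then have "min a b \<le> D / \<eta>" using \<eta>(1) by (simp add: D_def field_simps)
      moreover have "norm (x - y) \<le> 2" using norm_triangle_ineq4[of x y] xy by simp
      then have "a * b / (a + b) * norm (x - y) \<le> min a b * 2"
        using le_min ab by (intro mult_mono) auto
      moreover have "\<delta> * (a + b) \<ge> 0" using assms(3) ab by simp
      ultimately have "a * b / (a + b) * norm (x - y) \<le> \<delta> * (a + b) + D / \<eta> * 2"
        using order_trans[of "a * b / (a + b) * norm (x - y)" "min a b * 2" "D / \<eta> * 2"]
        by (intro add_increasing) (blast intro: mult_right_mono zero_le_numeral)+
      then show ?thesis by (simp add: mult.commute)
    qed
    then have "norm (v - (a / (a + b)) *\<^sub>R (v + w)) \<le> \<delta> * (a + b) + 2 / \<eta> * D"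
      by (simp only: nrm)
    moreover have "a / (a + b) \<in> {0..1}" using ab by simp
    ultimately show ?thesis by (metis a_def b_def D_def)
  qed
  then show ?thesis using \<eta>(1) by (intro exI[of _ "2 / \<eta>"]) auto
qed

section \<open>Signed measures and their Jordan decomposition\<close>

lemma vm_sums:
  assumes "borel_vector_measure \<mu>" "\<And>n::nat. A n \<in> sets borel" "disjoint_family A"
  shows "(\<lambda>n. \<mu> (A n)) sums \<mu> (\<Union>n. A n)"
  using assms unfolding borel_vector_measure_def by blast

lemma vm_empty:
  assumes "borel_vector_measure \<mu>"
  shows "\<mu> {} = 0"
proof -
  have "(\<lambda>n::nat. \<mu> {}) sums \<mu> (\<Union>n::nat. {})"
    by (rule vm_sums[OF assms]) (auto simp: disjoint_family_on_def)
  then have "(\<lambda>n::nat. \<mu> {}) \<longlonglongrightarrow> 0" by (intro summable_LIMSEQ_zero) (rule sums_summable)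
  then show ?thesis by (simp add: LIMSEQ_const_iff)
qed

lemma vm_Un:
  assumes "borel_vector_measure \<mu>" "A \<in> sets borel" "B \<in> sets borel" "A \<inter> B = {}"
  shows "\<mu> (A \<union> B) = \<mu> A + \<mu> B"
proof -
  have "(\<lambda>n. \<mu> (binaryset A B n)) sums \<mu> (\<Union>n. binaryset A B n)"
    using assms(2-4)
    by (intro vm_sums[OF assms(1)]) (auto simp: binaryset_def disjoint_family_on_def)
  moreover have "(\<lambda>n. \<mu> (binaryset A B n)) sums (\<mu> A + \<mu> B)"
    by (rule binaryset_sums) (rule vm_empty[OF assms(1)])
  ultimately show ?thesis by (metis UN_binaryset_eq sums_unique2)
qed

lemma vm_Diff:
  assumes "borel_vector_measure \<mu>" "A \<in> sets borel" "B \<in> sets borel" "B \<subseteq> A"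
  shows "\<mu> (A - B) = \<mu> A - \<mu> B"
proof -
  have "B \<union> (A - B) = A" using assms(4) by blast
  then show ?thesis using vm_Un[OF assms(1,3), of "A - B"] assms(2,3) by (auto simp: eq_diff_eq)
qed

lemma vm_bounded_linear:
  assumes "borel_vector_measure \<mu>" "bounded_linear l"
  shows "borel_vector_measure (\<lambda>A. l (\<mu> A))"
  using assms bounded_linear.sums unfolding borel_vector_measure_def by blast

text \<open>Without this bound the real-valued \<open>Sup\<close> in \<open>pos_variation\<close>
  would be an unspecified value rather than a supremum.\<close>

lemma signed_measure_bounded:
  fixes \<nu> :: "'a::topological_space set \<Rightarrow> real"
  assumes \<nu>: "borel_vector_measure \<nu>"
  shows "\<exists>K. \<forall>A\<in>sets borel. \<bar>\<nu> A\<bar> \<le> K"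
proof (rule ccontr)
  define bad where "bad A \<longleftrightarrow> A \<in> sets borel \<and> (\<forall>K. \<exists>B\<in>sets borel. B \<subseteq> A \<and> \<bar>\<nu> B\<bar> > K)" for A
  assume "\<nexists>K. \<forall>A\<in>sets borel. \<bar>\<nu> A\<bar> \<le> K"
  then have U: "bad UNIV" unfolding bad_def by (auto simp: not_le)
  \<comment> \<open>Cutting off pieces of mass at least 1 from ever smaller bad sets yields a disjoint sequence
    violating summability.\<close>
  have step: "\<exists>A'. bad A' \<and> A' \<subseteq> A \<and> \<bar>\<nu> (A - A')\<bar> \<ge> 1" if A: "bad A" for A
  proof -
    have Am: "A \<in> sets borel" using A by (simp add: bad_def)
    \<comment> \<open>The margin \<open>\<bar>\<nu> A\<bar> + 1\<close> makes both \<open>B\<close>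
      and \<open>A - B\<close> carry mass at least 1 in absolute value, so that whichever of them is
      bad can be kept and the other cut off.\<close>
    obtain B where B: "B \<in> sets borel" "B \<subseteq> A" "\<bar>\<nu> B\<bar> > \<bar>\<nu> A\<bar> + 1"
      using A unfolding bad_def by meson
    have D: "\<nu> (A - B) = \<nu> A - \<nu> B" by (rule vm_Diff[OF \<nu> Am B(1,2)])
    have "bad B \<or> bad (A - B)"
    proof (rule ccontr)
      assume "\<not> (bad B \<or> bad (A - B))"
      then have nb: "\<not> bad B" "\<not> bad (A - B)" by auto
      have "A - B \<in> sets borel" using Am B(1) by (rule sets.Diff)
      then have "\<exists>K. \<forall>C\<in>sets borel. C \<subseteq> A - B \<longrightarrow> \<bar>\<nu> C\<bar> \<le> K"
        using nb(2) by (simp add: bad_def not_less)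
      moreover have "\<exists>K. \<forall>C\<in>sets borel. C \<subseteq> B \<longrightarrow> \<bar>\<nu> C\<bar> \<le> K"
        using nb(1) B(1) by (simp add: bad_def not_less)
      ultimately obtain K1 K2 where
        K: "\<forall>C\<in>sets borel. C \<subseteq> B \<longrightarrow> \<bar>\<nu> C\<bar> \<le> K1"
           "\<forall>C\<in>sets borel. C \<subseteq> A - B \<longrightarrow> \<bar>\<nu> C\<bar> \<le> K2"
        by (elim exE)
      obtain C where C: "C \<in> sets borel" "C \<subseteq> A" "\<bar>\<nu> C\<bar> > K1 + K2"
        using A unfolding bad_def by meson
      have "(C \<inter> B) \<union> (C - B) = C" by blast
      then have "\<nu> C = \<nu> (C \<inter> B) + \<nu> (C - B)"
        using vm_Un[OF \<nu>, of "C \<inter> B" "C - B"] B(1) C(1) by auto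
      moreover have "\<bar>\<nu> (C \<inter> B)\<bar> \<le> K1" "\<bar>\<nu> (C - B)\<bar> \<le> K2"
        using K B(1) C(1,2) by (auto intro!: K[rule_format])
      ultimately show False using C(3) by linarith
    qed
    then show ?thesis
    proof
      assume "bad B"
      then show ?thesis using B D by (intro exI[of _ B]) linarith
    next
      assume b: "bad (A - B)"
      have "A - (A - B) = B" using B(2) by blast
      then show ?thesis using b B by (intro exI[of _ "A - B"]) auto
    qed
  qed
  have "\<forall>A. \<exists>A'. bad A \<longrightarrow> bad A' \<and> A' \<subseteq> A \<and> \<bar>\<nu> (A - A')\<bar> \<ge> 1"
    using step by blast
  from choice[OF this] obtain F
    where F: "\<And>A. bad A \<Longrightarrow> bad (F A) \<and> F A \<subseteq> A \<and> \<bar>\<nu> (A - F A)\<bar> \<ge> 1" by auto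
  define S where "S n = (F ^^ n) UNIV" for n
  have S: "bad (S n)" for n
    by (induction n) (auto simp: S_def U F)
  have SS: "S (Suc n) = F (S n)" for n by (simp add: S_def)
  have dec: "decseq S" by (rule decseq_SucI) (simp add: SS F S)
  define D where "D n = S n - S (Suc n)" for n
  have "disjoint_family D"
    unfolding disjoint_family_on_def
  proof (intro ballI impI)
    fix m n :: nat assume "m \<noteq> n"
    have *: "D i \<inter> D j = {}" if "i < j" for i j
      using decseqD[OF dec, of "Suc i" j] that by (auto simp: D_def)
    show "D m \<inter> D n = {}"
      using *[of m n] *[of n m] \<open>m \<noteq> n\<close> by (cases "m < n") (auto simp: Int_commute)
  qed
  moreover have "D n \<in> sets borel" for n using S by (auto simp: D_def bad_def)
  ultimately have "(\<lambda>n. \<nu> (D n)) sums \<nu> (\<Union>n. D n)" by (intro vm_sums[OF \<nu>])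
  then have "(\<lambda>n. \<nu> (D n)) \<longlonglongrightarrow> 0" by (intro summable_LIMSEQ_zero) (rule sums_summable)
  then obtain n where "\<bar>\<nu> (D n)\<bar> < 1"
    using LIMSEQ_D[of "\<lambda>n. \<nu> (D n)" 0 1] by auto
  then show False using F[OF S, of n] by (simp add: D_def SS)
qed

context
  fixes \<nu> :: "'a::topological_space set \<Rightarrow> real"
  assumes \<nu>: "borel_vector_measure \<nu>"
begin

lemma pos_variation_upper:
  assumes "B \<in> sets borel" "B \<subseteq> A"
  shows "\<nu> B \<le> pos_variation \<nu> A"
proof -
  obtain K where "\<forall>A\<in>sets borel. \<bar>\<nu> A\<bar> \<le> K" using signed_measure_bounded[OF \<nu>] by blast
  then have "bdd_above {\<nu> B |B. B \<in> sets borel \<and> B \<subseteq> A}"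
    by (intro bdd_aboveI[of _ K]) fastforce
  then show ?thesis unfolding pos_variation_def using assms by (intro cSup_upper) auto
qed

lemma pos_variation_least:
  assumes "\<And>B. B \<in> sets borel \<Longrightarrow> B \<subseteq> A \<Longrightarrow> \<nu> B \<le> K"
  shows "pos_variation \<nu> A \<le> K"
  unfolding pos_variation_def using assms by (intro cSup_least) (auto intro!: exI[of _ "{}"])

lemma pos_variation_nonneg: "0 \<le> pos_variation \<nu> A"
  using pos_variation_upper[of "{}" A] vm_empty[OF \<nu>] by simp

lemma pos_variation_mono: "A \<subseteq> B \<Longrightarrow> pos_variation \<nu> A \<le> pos_variation \<nu> B"
  by (rule pos_variation_least) (auto intro: pos_variation_upper)

lemma pos_variation_Un_ge:
  assumes "A \<in> sets borel" "B \<in> sets borel" "A \<inter> B = {}"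
  shows "pos_variation \<nu> A + pos_variation \<nu> B \<le> pos_variation \<nu> (A \<union> B)"
proof -
  have *: "\<nu> C + \<nu> D \<le> pos_variation \<nu> (A \<union> B)"
    if "C \<in> sets borel" "C \<subseteq> A" "D \<in> sets borel" "D \<subseteq> B" for C D
  proof -
    have "C \<inter> D = {}" using that assms by blast
    then have "\<nu> C + \<nu> D = \<nu> (C \<union> D)" using vm_Un[OF \<nu>] that by simp
    also have "\<dots> \<le> pos_variation \<nu> (A \<union> B)" using that by (intro pos_variation_upper) auto
    finally show ?thesis .
  qed
  have "pos_variation \<nu> B \<le> pos_variation \<nu> (A \<union> B) - \<nu> C"
    if "C \<in> sets borel" "C \<subseteq> A" for C
    using *[OF that] by (intro pos_variation_least) (simp add: le_diff_eq add.commute)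
  then have "pos_variation \<nu> A \<le> pos_variation \<nu> (A \<union> B) - pos_variation \<nu> B"
    by (intro pos_variation_least) (simp add: algebra_simps)
  then show ?thesis by simp
qed

text \<open>Superadditivity bounds all partial sums by the value on the union. Conversely a
  competitor \<open>B\<close> for the union is cut into the pieces \<open>B \<inter> A n\<close>,
  each of which competes for \<open>A n\<close>.\<close>

lemma pos_variation_sums:
  assumes A: "\<And>n::nat. A n \<in> sets borel" "disjoint_family A"
  shows "(\<lambda>n. pos_variation \<nu> (A n)) sums pos_variation \<nu> (\<Union>n. A n)"
proof -
  let ?p = "pos_variation \<nu>"
  have fin: "(\<Sum>i<n. ?p (A i)) \<le> ?p (\<Union>n. A n)" for n
  proof -
    have "(\<Sum>i<n. ?p (A i)) \<le> ?p (\<Union>i<n. A i)"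
    proof (induction n)
      case (Suc n)
      have "A i \<inter> A n = {}" if "i < n" for i
        using disjoint_family_onD[OF A(2), of i n] that by simp
      then have "(\<Union>i<n. A i) \<inter> A n = {}" by blast
      then have "?p (\<Union>i<n. A i) + ?p (A n) \<le> ?p ((\<Union>i<n. A i) \<union> A n)"
        using A(1) by (intro pos_variation_Un_ge) auto
      moreover have "(\<Union>i<n. A i) \<union> A n = (\<Union>i<Suc n. A i)" by (auto simp: lessThan_Suc)
      ultimately show ?case using Suc by simp
    qed (simp add: pos_variation_nonneg)
    also have "\<dots> \<le> ?p (\<Union>n. A n)" by (rule pos_variation_mono) auto
    finally show ?thesis .
  qed
  have summ: "summable (\<lambda>n. ?p (A n))"
    by (rule summableI_nonneg_bounded[OF pos_variation_nonneg fin])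
  have "?p (\<Union>n. A n) \<le> (\<Sum>n. ?p (A n))"
  proof (rule pos_variation_least)
    fix B assume B: "B \<in> sets borel" "B \<subseteq> (\<Union>n. A n)"
    have "(\<lambda>n. \<nu> (B \<inter> A n)) sums \<nu> (\<Union>n. B \<inter> A n)"
      using A B(1) by (intro vm_sums[OF \<nu>]) (auto simp: disjoint_family_on_def)
    moreover have "(\<Union>n. B \<inter> A n) = B" using B(2) by blast
    ultimately have s: "(\<lambda>n. \<nu> (B \<inter> A n)) sums \<nu> B" by simp
    have "\<nu> (B \<inter> A n) \<le> ?p (A n)" for n
      using A(1) B(1) by (intro pos_variation_upper) auto
    then show "\<nu> B \<le> (\<Sum>n. ?p (A n))"
      by (rule sums_le[OF _ s summable_sums[OF summ]])
  qed
  moreover have "(\<Sum>n. ?p (A n)) \<le> ?p (\<Union>n. A n)" by (rule suminf_le_const[OF summ fin])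
  ultimately have "(\<Sum>n. ?p (A n)) = ?p (\<Union>n. A n)" by (intro antisym)
  then show ?thesis using summable_sums[OF summ] by simp
qed

lemma sets_jordan_pos: "sets (jordan_pos \<nu>) = sets borel"
  and space_jordan_pos: "space (jordan_pos \<nu>) = UNIV"
  using sets.sigma_sets_eq[of borel] sets.space_closed[of borel]
  by (simp_all add: jordan_pos_def)

lemma emeasure_jordan_pos:
  assumes "A \<in> sets borel"
  shows "emeasure (jordan_pos \<nu>) A = ennreal (pos_variation \<nu> A)"
  unfolding jordan_pos_def
proof (rule emeasure_measure_of_sigma)
  show "sigma_algebra (UNIV :: 'a set) (sets borel)"
    using sets.sigma_algebra_axioms[of borel] by simp
  have "pos_variation \<nu> {} = 0"
    using vm_empty[OF \<nu>] pos_variation_nonneg[of "{}"]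
    by (intro antisym pos_variation_least) auto
  then show "positive (sets borel) (\<lambda>A. ennreal (pos_variation \<nu> A))"
    by (simp add: positive_def)
  show "countably_additive (sets borel) (\<lambda>A. ennreal (pos_variation \<nu> A))"
  proof (rule countably_additiveI)
    fix A :: "nat \<Rightarrow> 'a set" assume A: "range A \<subseteq> sets borel" "disjoint_family A"
    have "(\<lambda>n. pos_variation \<nu> (A n)) sums pos_variation \<nu> (\<Union>n. A n)"
      using A by (intro pos_variation_sums) auto
    then show "(\<Sum>i. ennreal (pos_variation \<nu> (A i))) = ennreal (pos_variation \<nu> (\<Union> (range A)))"
      using suminf_ennreal2[of "\<lambda>n. pos_variation \<nu> (A n)", OF pos_variation_nonneg sums_summable]
      by (simp only: sums_unique[symmetric])
  qed
qed (use assms in simp)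

lemma measure_jordan_pos:
  "A \<in> sets borel \<Longrightarrow> measure (jordan_pos \<nu>) A = pos_variation \<nu> A"
  by (simp add: measure_def emeasure_jordan_pos pos_variation_nonneg)

lemma finite_measure_jordan_pos: "finite_measure (jordan_pos \<nu>)"
  by (rule finite_measureI) (simp add: space_jordan_pos emeasure_jordan_pos)

end

lemma vm_uminus:
  "borel_vector_measure \<nu> \<Longrightarrow> borel_vector_measure (\<lambda>B. - \<nu> B)"
  by (rule vm_bounded_linear[OF _ bounded_linear_minus[OF bounded_linear_ident]])

text \<open>Passing from \<open>B\<close> to \<open>A - B\<close> turns \<open>\<nu> B\<close> into
  \<open>\<nu> A - \<nu> B\<close> and so exchanges the two suprema. This yields the Jordan
  decomposition without a Hahn decomposition.\<close>

lemma pos_variation_minus: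
  assumes \<nu>: "borel_vector_measure \<nu>" and A: "A \<in> sets borel"
  shows "pos_variation (\<lambda>B. - \<nu> B) A = pos_variation \<nu> A - \<nu> A"
proof (rule antisym)
  show "pos_variation (\<lambda>B. - \<nu> B) A \<le> pos_variation \<nu> A - \<nu> A"
  proof (rule pos_variation_least[OF vm_uminus[OF \<nu>]])
    fix B assume B: "B \<in> sets borel" "B \<subseteq> A"
    show "- \<nu> B \<le> pos_variation \<nu> A - \<nu> A"
      using pos_variation_upper[OF \<nu>, of "A - B" A] vm_Diff[OF \<nu> A B] A B by auto
  qed
  have "pos_variation \<nu> A \<le> pos_variation (\<lambda>B. - \<nu> B) A + \<nu> A"
  proof (rule pos_variation_least[OF \<nu>])
    fix B assume B: "B \<in> sets borel" "B \<subseteq> A"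
    show "\<nu> B \<le> pos_variation (\<lambda>B. - \<nu> B) A + \<nu> A"
      using pos_variation_upper[OF vm_uminus[OF \<nu>], of "A - B" A] vm_Diff[OF \<nu> A B] A B by auto
  qed
  then show "pos_variation \<nu> A - \<nu> A \<le> pos_variation (\<lambda>B. - \<nu> B) A" by simp
qed

lemma jordan_neg_eq: "jordan_neg \<nu> = jordan_pos (\<lambda>B. - \<nu> B)"
  by (simp add: jordan_neg_def jordan_pos_def)

lemma jordan_decomposition:
  assumes "borel_vector_measure \<nu>" "A \<in> sets borel"
  shows "\<nu> A = measure (jordan_pos \<nu>) A - measure (jordan_neg \<nu>) A"
  using assms by (simp add: jordan_neg_eq measure_jordan_pos vm_uminus pos_variation_minus)

section \<open>Integrals of bounded Borel functions\<close>

text \<open>The proof multiplies test functions by indicators of arbitrary Borel sets, which leads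
  out of \<open>Cc\<close>; this class contains both and is closed under products.\<close>

definition bounded_borel :: "('a::topological_space \<Rightarrow> real) set" where
  "bounded_borel = {f. f \<in> borel_measurable borel \<and> bounded (range f)}"

lemma bounded_borelI:
  "f \<in> borel_measurable borel \<Longrightarrow> (\<And>x. \<bar>f x\<bar> \<le> K) \<Longrightarrow> f \<in> bounded_borel"
  by (auto simp: bounded_borel_def bounded_iff)

lemma bounded_borelE:
  assumes "f \<in> bounded_borel"
  obtains K where "K > 0" "\<And>x. \<bar>f x\<bar> \<le> K" "f \<in> borel_measurable borel"
  using assms by (auto simp: bounded_borel_def bounded_pos)

lemma bounded_borel_measurable:
  "f \<in> bounded_borel \<Longrightarrow> f \<in> borel_measurable borel"
  by (simp add: bounded_borel_def)

lemma bounded_borel_const: "(\<lambda>x. c) \<in> bounded_borel"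
  by (rule bounded_borelI[where K="\<bar>c\<bar>"]) auto

lemma bounded_borel_indicator: "A \<in> sets borel \<Longrightarrow> indicator A \<in> bounded_borel"
  by (rule bounded_borelI[where K=1]) (auto simp: indicator_def)

lemma bounded_borel_add:
  assumes "f \<in> bounded_borel" "g \<in> bounded_borel"
  shows "(\<lambda>x. f x + g x) \<in> bounded_borel"
proof -
  obtain K L where "\<And>x. \<bar>f x\<bar> \<le> K" "\<And>x. \<bar>g x\<bar> \<le> L"
    "f \<in> borel_measurable borel" "g \<in> borel_measurable borel"
    using assms by (auto elim!: bounded_borelE)
  then show ?thesis
    by (intro bounded_borelI[where K="K + L"] borel_measurable_add order_trans[OF abs_triangle_ineq] add_mono)
qed

lemma bounded_borel_mult:
  assumes "f \<in> bounded_borel" "g \<in> bounded_borel"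
  shows "(\<lambda>x. f x * g x) \<in> bounded_borel"
proof -
  obtain K L where KL: "\<And>x. \<bar>f x\<bar> \<le> K" "\<And>x. \<bar>g x\<bar> \<le> L"
    "f \<in> borel_measurable borel" "g \<in> borel_measurable borel" "K > 0"
    using assms by (auto elim!: bounded_borelE)
  then show ?thesis
    by (intro bounded_borelI[where K="K * L"] borel_measurable_times) (auto simp: abs_mult intro!: mult_mono)
qed

lemma bounded_borel_cmult: "f \<in> bounded_borel \<Longrightarrow> (\<lambda>x. c * f x) \<in> bounded_borel"
  by (rule bounded_borel_mult[OF bounded_borel_const])

lemma bounded_borel_diff:
  assumes "f \<in> bounded_borel" "g \<in> bounded_borel"
  shows "(\<lambda>x. f x - g x) \<in> bounded_borel"
  using bounded_borel_add[OF assms(1) bounded_borel_cmult[OF assms(2), of "-1"]] by simp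

lemma bounded_borel_sum:
  "(\<And>i. i \<in> I \<Longrightarrow> f i \<in> bounded_borel) \<Longrightarrow> (\<lambda>x. \<Sum>i\<in>I. f i x) \<in> bounded_borel"
  by (induction I rule: infinite_finite_induct) (auto simp: bounded_borel_const bounded_borel_add)

lemma bounded_borel_abs:
  assumes "f \<in> bounded_borel"
  shows "(\<lambda>x. \<bar>f x\<bar>) \<in> bounded_borel"
proof -
  obtain K where "\<And>x. \<bar>f x\<bar> \<le> K" "f \<in> borel_measurable borel"
    using assms by (auto elim!: bounded_borelE)
  then show ?thesis by (intro bounded_borelI[where K=K] borel_measurable_abs) auto
qed

text \<open>An axiomatic description of integration against \<open>\<mu>\<close> that hides the
  description operator in \<open>vm_integral\<close> and the Jordan parts behind it. Linearity, the
  values on indicators and a bound in the supremum norm already determine \<open>J\<close> on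
  \<open>bounded_borel\<close>.\<close>

definition represents ::
    "(('a::topological_space \<Rightarrow> real) \<Rightarrow> 'v::real_normed_vector) \<Rightarrow> ('a set \<Rightarrow> 'v) \<Rightarrow> bool" where
  "represents J \<mu> \<longleftrightarrow>
     (\<forall>f\<in>bounded_borel. \<forall>g\<in>bounded_borel. J (\<lambda>x. f x + g x) = J f + J g) \<and>
     (\<forall>f\<in>bounded_borel. \<forall>c. J (\<lambda>x. c * f x) = c *\<^sub>R J f) \<and>
     (\<forall>A\<in>sets borel. J (indicator A) = \<mu> A) \<and>
     (\<exists>C\<ge>0. \<forall>f\<in>bounded_borel. \<forall>K. (\<forall>x. \<bar>f x\<bar> \<le> K) \<longrightarrow> norm (J f) \<le> C * K)"

lemma representsI:
  assumes "\<And>f g. f \<in> bounded_borel \<Longrightarrow> g \<in> bounded_borel \<Longrightarrow> J (\<lambda>x. f x + g x) = J f + J g"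
    and "\<And>f c. f \<in> bounded_borel \<Longrightarrow> J (\<lambda>x. c * f x) = c *\<^sub>R J f"
    and "\<And>A. A \<in> sets borel \<Longrightarrow> J (indicator A) = \<mu> A"
    and "C \<ge> 0" "\<And>f K. f \<in> bounded_borel \<Longrightarrow> (\<And>x. \<bar>f x\<bar> \<le> K) \<Longrightarrow> norm (J f) \<le> C * K"
  shows "represents J \<mu>"
  unfolding represents_def using assms by blast

lemma represents_cong:
  assumes "represents J \<mu>" "\<And>f. f \<in> bounded_borel \<Longrightarrow> J' f = J f"
  shows "represents J' \<mu>"
  using assms unfolding represents_def
  by (simp add: bounded_borel_add bounded_borel_cmult bounded_borel_indicator)

context
  fixes J :: "('a::topological_space \<Rightarrow> real) \<Rightarrow> 'v::real_normed_vector" and \<mu>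
  assumes J: "represents J \<mu>"
begin

lemma represents_add:
  "f \<in> bounded_borel \<Longrightarrow> g \<in> bounded_borel \<Longrightarrow> J (\<lambda>x. f x + g x) = J f + J g"
  using J by (simp add: represents_def)

lemma represents_cmult: "f \<in> bounded_borel \<Longrightarrow> J (\<lambda>x. c * f x) = c *\<^sub>R J f"
  using J by (simp add: represents_def)

lemma represents_indicator: "A \<in> sets borel \<Longrightarrow> J (indicator A) = \<mu> A"
  using J by (simp add: represents_def)

lemma represents_boundE:
  obtains C where "C \<ge> 0"
    "\<And>f K. f \<in> bounded_borel \<Longrightarrow> (\<And>x. \<bar>f x\<bar> \<le> K) \<Longrightarrow> norm (J f) \<le> C * K"
  using J unfolding represents_def by metis

lemma represents_diff:
  assumes "f \<in> bounded_borel" "g \<in> bounded_borel"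
  shows "J (\<lambda>x. f x - g x) = J f - J g"
  using represents_add[OF assms(1) bounded_borel_cmult[OF assms(2), of "-1"]]
    represents_cmult[OF assms(2), of "-1"] by simp

lemma represents_const: "J (\<lambda>x. c) = c *\<^sub>R \<mu> UNIV"
  using represents_cmult[OF bounded_borel_const[of 1], of c] represents_indicator[of UNIV]
  by (simp add: indicator_def[abs_def])

lemma represents_sum:
  assumes "\<And>i. i \<in> I \<Longrightarrow> f i \<in> bounded_borel"
  shows "J (\<lambda>x. \<Sum>i\<in>I. f i x) = (\<Sum>i\<in>I. J (f i))"
  using assms
  by (induction I rule: infinite_finite_induct)
    (auto simp: represents_add bounded_borel_sum represents_const)

end

section \<open>Averages over level sets (layer-cake formula)\<close>

lemma card_level_approx:
  fixes a b :: real and N :: nat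
  assumes "0 \<le> a" "a \<le> b" "b \<le> 1" "N > 0"
  shows "\<bar>(b - a) - (\<Sum>k=1..N. indicator {x. a < x \<and> x \<le> b} (real k / real N)) / real N\<bar> \<le> 1 / real N"
proof -
  \<comment> \<open>The grid points \<open>k / N\<close> lying in the half-open interval from
    \<open>a\<close> to \<open>b\<close> are counted by the difference of the floors of
    \<open>N * b\<close> and \<open>N * a\<close>, which differs from \<open>N * (b - a)\<close> by
    at most 1.\<close>
  let ?A = "nat \<lfloor>real N * a\<rfloor>" and ?B = "nat \<lfloor>real N * b\<rfloor>"
  have "real N * b \<le> real N * 1" using assms by (intro mult_left_mono) auto
  then have BN: "?B \<le> N" by linarith
  have ab: "real N * a \<le> real N * b" using assms by (intro mult_left_mono) auto
  then have AB: "?A \<le> ?B" by (intro nat_mono floor_mono)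
  have k1: "a < real k / real N \<longleftrightarrow> ?A < k" for k :: nat
  proof -
    have "a < real k / real N \<longleftrightarrow> real N * a < real k" using assms by (simp add: field_simps)
    also have "\<dots> \<longleftrightarrow> ?A < k" using assms by (simp add: nat_less_iff floor_less_iff)
    finally show ?thesis .
  qed
  have k2: "real k / real N \<le> b \<longleftrightarrow> k \<le> ?B" for k :: nat
  proof -
    have "real k / real N \<le> b \<longleftrightarrow> real k \<le> real N * b" using assms by (simp add: field_simps)
    also have "\<dots> \<longleftrightarrow> k \<le> ?B" using assms by (simp add: le_nat_iff le_floor_iff)
    finally show ?thesis .
  qed
  have "(\<Sum>k=1..N. indicator {x. a < x \<and> x \<le> b} (real k / real N)) =
      (\<Sum>k=1..N. indicator {?A<..?B} k :: real)"
    by (intro sum.cong refl) (simp add: indicator_def k1 k2)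
  also have "\<dots> = real (card ({1..N} \<inter> {?A<..?B}))" by (simp add: indicator_def Int_def)
  also have "{1..N} \<inter> {?A<..?B} = {?A<..?B}" using BN by auto
  also have "real (card {?A<..?B}) = real ?B - real ?A" using AB by simp
  finally have eq: "(\<Sum>k=1..N. indicator {x. a < x \<and> x \<le> b} (real k / real N)) = real ?B - real ?A" .
  have "0 \<le> real N * a" "0 \<le> real N * b" using assms by auto
  then have "\<bar>real N * (b - a) - (real ?B - real ?A)\<bar> \<le> 1"
    by (simp add: algebra_simps) linarith
  then have "\<bar>real N * (b - a) - (real ?B - real ?A)\<bar> / real N \<le> 1 / real N"
    by (intro divide_right_mono) auto
  moreover have "\<bar>real N * (b - a) - (real ?B - real ?A)\<bar> / real N
      = \<bar>(b - a) - (real ?B - real ?A) / real N\<bar>"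
  proof -
    have "(b - a) - (real ?B - real ?A) / real N = (real N * (b - a) - (real ?B - real ?A)) / real N"
      using assms(4) by (simp add: field_simps)
    then show ?thesis by simp
  qed
  ultimately show ?thesis unfolding eq by simp
qed

lemma level_set_borel:
  assumes "a \<in> bounded_borel" "b \<in> bounded_borel"
  shows "{x. a x < c \<and> c \<le> b x} \<in> sets borel"
proof -
  have [measurable]: "a \<in> borel_measurable borel" "b \<in> borel_measurable borel"
    using assms by (auto simp: bounded_borel_def)
  show ?thesis by measurable
qed

text \<open>The average of the indicators over the \<open>N\<close> levels is within
  \<open>1 / N\<close> of \<open>b - a\<close> in the supremum norm, and \<open>J\<close> is bounded
  in that norm. \<open>C\<close> is independent of \<open>a\<close>, \<open>b\<close> and
  \<open>N\<close>. A lower function \<open>a\<close> is included so that consecutive partial sums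
  can be treated, whose level sets are disjoint.\<close>

lemma level_average:
  assumes J: "represents J \<mu>"
  obtains C where "C \<ge> 0"
    "\<And>a b N. a \<in> bounded_borel \<Longrightarrow> b \<in> bounded_borel \<Longrightarrow> (\<And>x. 0 \<le> a x) \<Longrightarrow> (\<And>x. a x \<le> b x) \<Longrightarrow>
      (\<And>x. b x \<le> 1) \<Longrightarrow> (N::nat) > 0 \<Longrightarrow>
      norm (J (\<lambda>x. b x - a x) - (\<Sum>k=1..N. (1 / real N) *\<^sub>R \<mu> {x. a x < real k / real N \<and> real k / real N \<le> b x}))
        \<le> C / real N"
proof -
  obtain C where C: "C \<ge> 0"
    "\<And>f K. f \<in> bounded_borel \<Longrightarrow> (\<And>x. \<bar>f x\<bar> \<le> K) \<Longrightarrow> norm (J f) \<le> C * K"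
    using represents_boundE[OF J] by blast
  have "norm (J (\<lambda>x. b x - a x) - (\<Sum>k=1..N. (1 / real N) *\<^sub>R \<mu> {x. a x < real k / real N \<and> real k / real N \<le> b x}))
        \<le> C / real N"
    if a: "a \<in> bounded_borel" and b: "b \<in> bounded_borel" and ab: "\<And>x. 0 \<le> a x" "\<And>x. a x \<le> b x"
      "\<And>x. b x \<le> 1" and N: "(N::nat) > 0" for a b N
  proof -
    let ?E = "\<lambda>k::nat. {x. a x < real k / real N \<and> real k / real N \<le> b x}"
    have E: "?E k \<in> sets borel" for k by (rule level_set_borel[OF a b])
    let ?g = "\<lambda>x. \<Sum>k=1..N. (1 / real N) * indicator (?E k) x"
    have g: "?g \<in> bounded_borel"
      by (intro bounded_borel_sum bounded_borel_cmult bounded_borel_indicator E)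
    have "J ?g = (\<Sum>k=1..N. J (\<lambda>x. (1 / real N) * indicator (?E k) x))"
      by (intro represents_sum[OF J] bounded_borel_cmult bounded_borel_indicator E)
    also have "\<dots> = (\<Sum>k=1..N. (1 / real N) *\<^sub>R \<mu> (?E k))"
      by (intro sum.cong refl)
        (simp only: represents_cmult[OF J bounded_borel_indicator[OF E]] represents_indicator[OF J E])
    finally have Jg: "J ?g = (\<Sum>k=1..N. (1 / real N) *\<^sub>R \<mu> (?E k))" .
    have "\<bar>(b x - a x) - ?g x\<bar> \<le> 1 / real N" for x
    proof -
      have "?g x = (\<Sum>k=1..N. indicator {t. a x < t \<and> t \<le> b x} (real k / real N)) / real N"
        by (subst sum_divide_distrib) (auto simp: indicator_def intro!: sum.cong)
      then show ?thesis using card_level_approx[OF ab(1,2,3) N, of x] by simp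
    qed
    then have "norm (J (\<lambda>x. (b x - a x) - ?g x)) \<le> C * (1 / real N)"
      by (intro C(2) bounded_borel_diff a b g)
    then show ?thesis
      using represents_diff[OF J bounded_borel_diff[OF b a] g] Jg by simp
  qed
  then show ?thesis using C(1) that by blast
qed

lemma tendsto_const_over_n: "(\<lambda>n. c / real (Suc n)) \<longlonglongrightarrow> 0"
  using tendsto_mult_right[OF LIMSEQ_inverse_real_of_nat, of c] by (simp add: divide_inverse mult.commute)

text \<open>The case of lower function 0 in \<open>level_average\<close>; this is the origin of the
  condition \<open>0 < real k / real (Suc n)\<close>, which holds for every \<open>k\<close> in the
  sum. The approximating averages do not mention \<open>J\<close>.\<close>

lemma represents_levels_tendsto:
  assumes J: "represents J \<mu>" and f: "f \<in> bounded_borel" "\<And>x. 0 \<le> f x" "\<And>x. f x \<le> 1"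
  shows "(\<lambda>n. \<Sum>k=1..Suc n. (1 / real (Suc n)) *\<^sub>R \<mu> {x. 0 < real k / real (Suc n) \<and> real k / real (Suc n) \<le> f x})
    \<longlonglongrightarrow> J f" (is "?S \<longlonglongrightarrow> _")
proof -
  obtain C where C: "C \<ge> 0"
    "\<And>a b N. a \<in> bounded_borel \<Longrightarrow> b \<in> bounded_borel \<Longrightarrow> (\<And>x. 0 \<le> a x) \<Longrightarrow> (\<And>x. a x \<le> b x) \<Longrightarrow>
      (\<And>x. b x \<le> 1) \<Longrightarrow> (N::nat) > 0 \<Longrightarrow>
      norm (J (\<lambda>x. b x - a x) - (\<Sum>k=1..N. (1 / real N) *\<^sub>R \<mu> {x. a x < real k / real N \<and> real k / real N \<le> b x}))
        \<le> C / real N"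
    by (rule level_average[OF J]) blast
  have "norm (?S n - J f) \<le> C / real (Suc n)" for n
    using C(2)[OF bounded_borel_const f(1), of 0 "Suc n"] f(2,3) by (simp add: norm_minus_commute)
  then have "(\<lambda>n. ?S n - J f) \<longlonglongrightarrow> 0"
    by (intro Lim_null_comparison[OF _ tendsto_const_over_n[of C]] always_eventually) simp
  then show ?thesis by (simp add: LIM_zero_iff)
qed

text \<open>
  A functional representing \<open>\<mu>\<close> is a uniform limit of layer-cake averages
  \<open>(1/N) \<Sum>\<^sub>k \<mu> {f \<ge> k/N}\<close>, which depend on \<open>\<mu>\<close> only.
\<close>

lemma represents_unique:
  assumes J: "represents J \<mu>" and J': "represents J' \<mu>" and f: "f \<in> bounded_borel"
  shows "J f = J' f"
proof -
  obtain K where K: "K > 0" "\<And>x. \<bar>f x\<bar> \<le> K" using f by (auto elim!: bounded_borelE)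
  \<comment> \<open>An affine rescaling brings \<open>f\<close> into \<open>[0,1]\<close>, where the
    averages apply; linearity and the value on constants undo it.\<close>
  define g where "g x = (1 / (2 * K)) * (f x + K)" for x
  have g: "g \<in> bounded_borel"
    unfolding g_def by (intro bounded_borel_cmult bounded_borel_add f bounded_borel_const)
  have "0 \<le> g x \<and> g x \<le> 1" for x
    using K(1) K(2)[of x] unfolding g_def by (auto simp: abs_le_iff field_simps)
  then have eq: "J g = J' g"
    by (intro LIMSEQ_unique[OF represents_levels_tendsto[OF J g] represents_levels_tendsto[OF J' g]]) auto
  have *: "L f = (2 * K) *\<^sub>R L g - K *\<^sub>R \<mu> UNIV" if L: "represents L \<mu>" for L
  proof -
    have "f = (\<lambda>x. (2 * K) * g x - K)" using K(1) by (auto simp: g_def field_simps)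
    then have "L f = L (\<lambda>x. (2 * K) * g x - K)" by (rule arg_cong)
    then show ?thesis
      by (simp only: represents_diff[OF L bounded_borel_cmult[OF g] bounded_borel_const]
          represents_cmult[OF L g] represents_const[OF L])
  qed
  show ?thesis by (simp only: *[OF J] *[OF J'] eq)
qed

text \<open>The averages over level sets are convex combinations, with equal weights, of values of
  \<open>\<mu>\<close>, so their limit lies in the closed convex hull.\<close>

lemma represents_in_vm_range:
  assumes J: "represents J \<mu>" and f: "f \<in> bounded_borel" "\<And>x. 0 \<le> f x" "\<And>x. f x \<le> 1"
  shows "J f \<in> vm_range \<mu>"
proof -
  let ?H = "convex hull {\<mu> E | E. E \<in> sets borel}"
  let ?S = "\<lambda>n. \<Sum>k=1..Suc n. (1 / real (Suc n)) *\<^sub>R \<mu> {x. 0 < real k / real (Suc n) \<and> real k / real (Suc n) \<le> f x}"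
  have "?S n \<in> ?H" for n
  proof (rule convex_sum)
    fix k assume "k \<in> {1..Suc n}"
    show "\<mu> {x. 0 < real k / real (Suc n) \<and> real k / real (Suc n) \<le> f x} \<in> ?H"
      using level_set_borel[OF bounded_borel_const f(1)] by (intro hull_inc) blast
  qed auto
  then show ?thesis
    unfolding vm_range_def closure_sequential using represents_levels_tendsto[OF J f]
    by (intro exI[of _ ?S]) simp
qed

text \<open>
  Randomised rounding: with \<open>a i\<close> the partial sums of the \<open>\<psi> j\<close>, the sets
  \<open>{a i < s \<le> a (Suc i)}\<close> are disjoint for each level \<open>s\<close>, and averaging their indicators over
  \<open>s \<in> (0,1]\<close> gives back \<open>\<psi> i\<close>.
\<close>

lemma represents_sum_norm_le:
  assumes J: "represents J \<mu>" and \<psi>: "\<And>i. i < (m::nat) \<Longrightarrow> \<psi> i \<in> bounded_borel"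
    "\<And>i x. i < m \<Longrightarrow> 0 \<le> \<psi> i x" "\<And>x. (\<Sum>i<m. \<psi> i x) \<le> 1"
    and V: "\<And>E. (\<And>i. i < m \<Longrightarrow> E i \<in> sets borel) \<Longrightarrow> disjoint_family_on E {..<m} \<Longrightarrow> (\<Sum>i<m. norm (\<mu> (E i))) \<le> V"
  shows "(\<Sum>i<m. norm (J (\<psi> i))) \<le> V"
proof -
  define a where "a i x = (\<Sum>j<i. \<psi> j x)" for i x
  have abb: "a i \<in> bounded_borel" if "i \<le> m" for i
    unfolding a_def by (intro bounded_borel_sum \<psi>(1)) (use that in auto)
  have amono: "a i x \<le> a j x" if "i \<le> j" "j \<le> m" for i j x
    unfolding a_def by (intro sum_mono2) (use that \<psi>(2) in auto)
  have a0: "0 \<le> a i x" if "i \<le> m" for i x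
    unfolding a_def by (intro sum_nonneg \<psi>(2)) (use that in auto)
  have a1: "a i x \<le> 1" if "i \<le> m" for i x
    using amono[OF that, of x] \<psi>(3)[of x] by (simp add: a_def)
  have asuc: "a (Suc i) x - a i x = \<psi> i x" for i x by (simp add: a_def)
  obtain C where C: "C \<ge> 0"
    "\<And>a b N. a \<in> bounded_borel \<Longrightarrow> b \<in> bounded_borel \<Longrightarrow> (\<And>x. 0 \<le> a x) \<Longrightarrow> (\<And>x. a x \<le> b x) \<Longrightarrow>
      (\<And>x. b x \<le> 1) \<Longrightarrow> (N::nat) > 0 \<Longrightarrow>
      norm (J (\<lambda>x. b x - a x) - (\<Sum>k=1..N. (1 / real N) *\<^sub>R \<mu> {x. a x < real k / real N \<and> real k / real N \<le> b x}))
        \<le> C / real N"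
    by (rule level_average[OF J]) blast
  \<comment> \<open>On each level the sets are disjoint and contribute at most \<open>V\<close>,
    hence so does the average over the levels. Each of the \<open>m\<close> approximations costs
    \<open>C / real (Suc n)\<close>, which vanishes as \<open>n\<close> grows.\<close>
  have "(\<Sum>i<m. norm (J (\<psi> i))) \<le> real m * C / real (Suc n) + V" for n
  proof -
    let ?N = "real (Suc n)"
    define E where "E k i = {x. a i x < real k / ?N \<and> real k / ?N \<le> a (Suc i) x}" for k i
    have "(\<Sum>i<m. norm (\<mu> (E k i))) \<le> V" for k
    proof (rule V)
      show "E k i \<in> sets borel" if "i < m" for i
        unfolding E_def using that by (intro level_set_borel abb) auto
      have *: "E k i \<inter> E k j = {}" if "i < j" "j < m" for i j
      proof (rule equals0I)
        fix x assume "x \<in> E k i \<inter> E k j"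
        then have "real k / ?N \<le> a (Suc i) x" "a j x < real k / ?N"
          by (auto simp only: E_def Int_iff mem_Collect_eq)
        moreover have "a (Suc i) x \<le> a j x" using that by (intro amono) auto
        ultimately show False by linarith
      qed
      show "disjoint_family_on (E k) {..<m}"
        unfolding disjoint_family_on_def
        using * by (metis Int_commute lessThan_iff linorder_neqE_nat)
    qed
    then have "(\<Sum>k=1..Suc n. \<Sum>i<m. norm (\<mu> (E k i))) \<le> (\<Sum>k=1..Suc n. V)"
      by (intro sum_mono) simp
    then have avg: "(\<Sum>k=1..Suc n. \<Sum>i<m. norm (\<mu> (E k i))) \<le> ?N * V" by simp
    have "norm (J (\<psi> i)) \<le> C / ?N + (\<Sum>k=1..Suc n. (1 / ?N) * norm (\<mu> (E k i)))" if "i < m" for i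
    proof -
      have "norm (J (\<lambda>x. a (Suc i) x - a i x) - (\<Sum>k=1..Suc n. (1 / ?N) *\<^sub>R \<mu> (E k i))) \<le> C / ?N"
        unfolding E_def using that by (intro C(2) abb a0 a1 amono) auto
      then have "norm (J (\<psi> i) - (\<Sum>k=1..Suc n. (1 / ?N) *\<^sub>R \<mu> (E k i))) \<le> C / ?N"
        by (simp only: asuc)
      then have "norm (J (\<psi> i)) \<le> C / ?N + norm (\<Sum>k=1..Suc n. (1 / ?N) *\<^sub>R \<mu> (E k i))"
        by (smt (verit) norm_triangle_sub)
      also have "norm (\<Sum>k=1..Suc n. (1 / ?N) *\<^sub>R \<mu> (E k i)) \<le> (\<Sum>k=1..Suc n. norm ((1 / ?N) *\<^sub>R \<mu> (E k i)))"
        by (rule norm_sum)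
      finally show ?thesis by simp
    qed
    then have "(\<Sum>i<m. norm (J (\<psi> i))) \<le> (\<Sum>i<m. C / ?N + (\<Sum>k=1..Suc n. (1 / ?N) * norm (\<mu> (E k i))))"
      by (intro sum_mono) simp
    also have "\<dots> = real m * C / ?N + (1 / ?N) * (\<Sum>k=1..Suc n. \<Sum>i<m. norm (\<mu> (E k i)))"
      by (simp only: sum.distrib sum_distrib_left[symmetric] sum.swap[of _ "{1..Suc n}" "{..<m}"]
          sum_constant card_lessThan) simp
    also have "\<dots> \<le> real m * C / ?N + (1 / ?N) * (?N * V)"
      using avg by (intro add_left_mono mult_left_mono) auto
    finally show ?thesis by simp
  qed
  moreover have "(\<lambda>n. real m * C / real (Suc n) + V) \<longlonglongrightarrow> 0 + V"
    by (intro tendsto_intros tendsto_const_over_n)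
  ultimately show ?thesis by (intro LIMSEQ_le_const) auto
qed

section \<open>The integral with respect to a vector measure\<close>

lemma integrable_bounded_borel:
  assumes "finite_measure M" "sets M = sets borel" "f \<in> bounded_borel"
  shows "integrable M f"
proof -
  interpret finite_measure M by fact
  obtain K where "\<And>x. \<bar>f x\<bar> \<le> K" and f: "f \<in> borel_measurable borel"
    using assms(3) by (auto elim!: bounded_borelE)
  moreover have "f \<in> borel_measurable M"
    using f by (simp add: measurable_cong_sets[OF assms(2) refl])
  ultimately show ?thesis by (intro integrable_const_bound[where B=K]) auto
qed

lemma represents_lebesgue_integral:
  assumes M: "finite_measure M" "sets M = sets (borel :: 'a::topological_space measure)"
  shows "represents (\<lambda>f. \<integral>x. f x \<partial>M) (measure M)"
proof (rule representsI[where C="measure M UNIV"])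
  have sp: "space M = UNIV" using sets_eq_imp_space_eq[OF M(2)] by simp
  interpret finite_measure M by fact
  fix f g :: "'a \<Rightarrow> real" assume f: "f \<in> bounded_borel"
  note fi = integrable_bounded_borel[OF M f]
  show "(\<integral>x. c * f x \<partial>M) = c *\<^sub>R (\<integral>x. f x \<partial>M)" for c by simp
  show "norm (\<integral>x. f x \<partial>M) \<le> measure M UNIV * K" if "\<And>x. \<bar>f x\<bar> \<le> K" for K
  proof -
    have "norm (\<integral>x. f x \<partial>M) \<le> (\<integral>x. norm (f x) \<partial>M)" by (rule integral_norm_bound)
    also have "\<dots> \<le> (\<integral>x. K \<partial>M)"
      using that fi by (intro integral_mono integrable_norm) auto
    also have "\<dots> = measure M UNIV * K" by (simp add: sp)
    finally show ?thesis .
  qed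
  assume g: "g \<in> bounded_borel"
  show "(\<integral>x. f x + g x \<partial>M) = (\<integral>x. f x \<partial>M) + (\<integral>x. g x \<partial>M)"
    using fi integrable_bounded_borel[OF M g] by (rule Bochner_Integration.integral_add)
next
  show "(\<integral>x. indicator A x \<partial>M) = measure M A" if "A \<in> sets borel" for A
    using that M(2) by simp
qed simp

text \<open>Stated for general families because it serves several purposes: composition with a
  functional, the difference of the two Jordan parts, the assembly of coordinates into a vector, and
  sums of measures.\<close>

lemma represents_lincomb:
  fixes J :: "'i \<Rightarrow> ('a::topological_space \<Rightarrow> real) \<Rightarrow> 'b::real_normed_vector"
    and L :: "'i \<Rightarrow> 'b \<Rightarrow> 'v::real_normed_vector"
  assumes "finite I" "\<And>i. i \<in> I \<Longrightarrow> represents (J i) (\<nu> i)" "\<And>i. i \<in> I \<Longrightarrow> bounded_linear (L i)"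
  shows "represents (\<lambda>f. \<Sum>i\<in>I. L i (J i f)) (\<lambda>A. \<Sum>i\<in>I. L i (\<nu> i A))"
proof -
  have "\<exists>C. C \<ge> 0 \<and> (\<forall>f\<in>bounded_borel. \<forall>K. (\<forall>x. \<bar>f x\<bar> \<le> K) \<longrightarrow> norm (L i (J i f)) \<le> C * K)" if i: "i \<in> I" for i
  proof -
    obtain C where C: "C \<ge> 0"
      "\<And>f K. f \<in> bounded_borel \<Longrightarrow> (\<And>x. \<bar>f x\<bar> \<le> K) \<Longrightarrow> norm (J i f) \<le> C * K"
      using represents_boundE[OF assms(2)[OF i]] by blast
    obtain D where D: "D > 0" "\<And>x. norm (L i x) \<le> norm x * D"
      using bounded_linear.pos_bounded[OF assms(3)[OF i]] by blast
    have "norm (L i (J i f)) \<le> C * D * K" if "f \<in> bounded_borel" "\<And>x. \<bar>f x\<bar> \<le> K" for f K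
    proof -
      have "norm (L i (J i f)) \<le> norm (J i f) * D" by (rule D)
      also have "\<dots> \<le> C * K * D" using C(2)[OF that] D(1) by (intro mult_right_mono) auto
      finally show ?thesis by (simp add: mult_ac)
    qed
    then show ?thesis using C(1) D(1) by (intro exI[of _ "C * D"]) auto
  qed
  then have "\<forall>i\<in>I. \<exists>C. C \<ge> 0 \<and> (\<forall>f\<in>bounded_borel. \<forall>K. (\<forall>x. \<bar>f x\<bar> \<le> K) \<longrightarrow> norm (L i (J i f)) \<le> C * K)"
    by blast
  from bchoice[OF this] obtain C where C': "\<forall>i\<in>I. C i \<ge> 0 \<and>
    (\<forall>f\<in>bounded_borel. \<forall>K. (\<forall>x. \<bar>f x\<bar> \<le> K) \<longrightarrow> norm (L i (J i f)) \<le> C i * K)" ..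
  then have C: "C i \<ge> 0" "f \<in> bounded_borel \<Longrightarrow> (\<And>x. \<bar>f x\<bar> \<le> K) \<Longrightarrow> norm (L i (J i f)) \<le> C i * K"
    if "i \<in> I" for i K and f :: "'a \<Rightarrow> real"
    using that by auto
  show ?thesis
  proof (rule representsI[where C="\<Sum>i\<in>I. C i"])
    fix f :: "'a \<Rightarrow> real" and K assume f: "f \<in> bounded_borel" "\<And>x. \<bar>f x\<bar> \<le> K"
    have "norm (\<Sum>i\<in>I. L i (J i f)) \<le> (\<Sum>i\<in>I. norm (L i (J i f)))" by (rule norm_sum)
    also have "\<dots> \<le> (\<Sum>i\<in>I. C i * K)" using f by (intro sum_mono C(2)) auto
    finally show "norm (\<Sum>i\<in>I. L i (J i f)) \<le> (\<Sum>i\<in>I. C i) * K" by (simp add: sum_distrib_right)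
  next
    fix f g :: "'a \<Rightarrow> real" assume "f \<in> bounded_borel" "g \<in> bounded_borel"
    then show "(\<Sum>i\<in>I. L i (J i (\<lambda>x. f x + g x))) = (\<Sum>i\<in>I. L i (J i f)) + (\<Sum>i\<in>I. L i (J i g))"
      unfolding sum.distrib[symmetric]
      by (intro sum.cong refl)
        (simp add: represents_add[OF assms(2)] linear_add[OF bounded_linear.linear[OF assms(3)]])
  next
    fix f :: "'a \<Rightarrow> real" and c :: real assume "f \<in> bounded_borel"
    then show "(\<Sum>i\<in>I. L i (J i (\<lambda>x. c * f x))) = c *\<^sub>R (\<Sum>i\<in>I. L i (J i f))"
      unfolding scaleR_sum_right
      by (intro sum.cong refl)
        (simp add: represents_cmult[OF assms(2)] linear_scale[OF bounded_linear.linear[OF assms(3)]])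
  next
    fix A :: "'a set" assume "A \<in> sets borel"
    then show "(\<Sum>i\<in>I. L i (J i (indicator A))) = (\<Sum>i\<in>I. L i (\<nu> i A))"
      by (intro sum.cong refl) (simp add: represents_indicator[OF assms(2)])
  qed (intro sum_nonneg C(1))
qed

lemma represents_bounded_linear:
  assumes "represents J \<mu>" "bounded_linear l"
  shows "represents (\<lambda>f. l (J f)) (\<lambda>A. l (\<mu> A))"
  using represents_lincomb[of "{()}" "\<lambda>_. J" "\<lambda>_. \<mu>" "\<lambda>_. l"] assms by simp

lemma represents_measure_cong:
  assumes "represents J \<mu>" "\<And>A. A \<in> sets borel \<Longrightarrow> \<mu> A = \<mu>' A"
  shows "represents J \<mu>'"
  using assms unfolding represents_def by simp

lemma finite_measure_jordan_neg: "borel_vector_measure \<nu> \<Longrightarrow> finite_measure (jordan_neg \<nu>)"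
  by (simp add: jordan_neg_eq finite_measure_jordan_pos vm_uminus)

lemma sets_jordan_neg: "borel_vector_measure \<nu> \<Longrightarrow> sets (jordan_neg \<nu>) = sets borel"
  by (simp add: jordan_neg_eq sets_jordan_pos vm_uminus)

lemma represents_signed_integral:
  assumes \<nu>: "borel_vector_measure \<nu>"
  shows "represents (signed_integral \<nu>) \<nu>"
proof -
  \<comment> \<open>The two Jordan parts are indexed by \<open>bool\<close>: \<open>True\<close> is
    the positive part with sign \<open>id\<close>, \<open>False\<close> the negative part with sign
    \<open>uminus\<close>.\<close>
  have "represents (\<lambda>f. \<Sum>i\<in>UNIV. (if i then id else uminus) (\<integral>x. f x \<partial>(if i then jordan_pos \<nu> else jordan_neg \<nu>)))
    (\<lambda>A. \<Sum>i\<in>UNIV. (if i then id else uminus) (measure (if i then jordan_pos \<nu> else jordan_neg \<nu>) A))"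
    using bounded_linear_ident bounded_linear_minus[OF bounded_linear_ident]
    by (intro represents_lincomb represents_lebesgue_integral)
      (auto simp: id_def finite_measure_jordan_pos finite_measure_jordan_neg sets_jordan_pos sets_jordan_neg \<nu>)
  then have "represents (signed_integral \<nu>) (\<lambda>A. measure (jordan_pos \<nu>) A - measure (jordan_neg \<nu>) A)"
    by (simp add: UNIV_bool signed_integral_def[abs_def] add.commute)
  then show ?thesis by (rule represents_measure_cong) (simp add: jordan_decomposition[OF \<nu>])
qed

lemma abs_signed_integral_le:
  "\<bar>signed_integral \<nu> f\<bar> \<le> (\<integral>x. \<bar>f x\<bar> \<partial>jordan_pos \<nu>) + (\<integral>x. \<bar>f x\<bar> \<partial>jordan_neg \<nu>)"
  using integral_norm_bound[of "jordan_pos \<nu>" f] integral_norm_bound[of "jordan_neg \<nu>" f]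
  by (simp add: signed_integral_def) (rule order_trans[OF abs_triangle_ineq4 add_mono], simp_all)

section \<open>Coordinates and the value of \<open>vm_integral\<close>\<close>

lemma finite_dim_coordinates:
  assumes fd: "finite_dim_space TYPE('v::real_normed_vector)"
  obtains B and r :: "'v::real_normed_vector \<Rightarrow> 'v \<Rightarrow> real" where "finite B" "\<And>b. bounded_linear (r b)"
    "\<And>v. (\<Sum>b\<in>B. r b v *\<^sub>R b) = v"
proof -
  obtain T :: "'v set" where T: "finite T" "span T = UNIV"
    using fd by (auto simp: finite_dim_space_def)
  obtain B where B: "B \<subseteq> (UNIV :: 'v set)" "independent B" "UNIV \<subseteq> span B"
    by (rule maximal_independent_subset)
  have fin: "finite B" using independent_span_bound[OF T(1) B(2)] T(2) by auto
  let ?r = "\<lambda>b v. representation B v b"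
  have "linear (?r b)" for b
    using B by (intro linearI)
      (auto simp: real_vector.representation_add real_vector.representation_scale subset_iff)
  then have "bounded_linear (?r b)" for b by (rule finite_dim_bounded_linear[OF fd])
  moreover have "(\<Sum>b\<in>B. ?r b v *\<^sub>R b) = v" for v
    using B fin by (intro real_vector.sum_representation_eq) auto
  ultimately show ?thesis using fin that[of B ?r] by blast
qed

context
  fixes \<mu> :: "'a::topological_space set \<Rightarrow> 'v::real_normed_vector"
  assumes fd: "finite_dim_space TYPE('v)" and \<mu>: "borel_vector_measure \<mu>"
begin

lemma represents_coordinates:
  assumes B: "finite B" "\<And>b. bounded_linear (r b)" "\<And>v. (\<Sum>b\<in>B. r b v *\<^sub>R b) = v"
  shows "represents (\<lambda>f. \<Sum>b\<in>B. signed_integral (\<lambda>A. r b (\<mu> A)) f *\<^sub>R b) \<mu>"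
proof -
  have "represents (\<lambda>f. \<Sum>b\<in>B. signed_integral (\<lambda>A. r b (\<mu> A)) f *\<^sub>R b) (\<lambda>A. \<Sum>b\<in>B. r b (\<mu> A) *\<^sub>R b)"
    using B by (intro represents_lincomb represents_signed_integral vm_bounded_linear[OF \<mu>]
        bounded_linear_scaleR_left)
  then show ?thesis by (simp add: B(3))
qed

text \<open>This resolves the description operator. The coordinatewise integral represents
  \<open>\<mu>\<close>, so its image under a linear functional \<open>l\<close> represents
  \<open>l\<close> composed with \<open>\<mu>\<close>, as does the signed integral; uniqueness
  identifies the two. Finite dimension enters by making every linear \<open>l\<close>
  bounded.\<close>

lemma vm_integral_eq:
  assumes B: "finite B" "\<And>b. bounded_linear (r b)" "\<And>v. (\<Sum>b\<in>B. r b v *\<^sub>R b) = v"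
    and f: "f \<in> bounded_borel"
  shows "vm_integral \<mu> f = (\<Sum>b\<in>B. signed_integral (\<lambda>A. r b (\<mu> A)) f *\<^sub>R b)" (is "_ = ?J f")
  unfolding vm_integral_def
proof (rule the_equality)
  have J: "represents ?J \<mu>" by (rule represents_coordinates[OF B])
  have *: "l (?J f) = signed_integral (\<lambda>A. l (\<mu> A)) f" if "linear l" for l :: "'v \<Rightarrow> real"
  proof -
    have "bounded_linear l" using finite_dim_bounded_linear[OF fd that] .
    then show ?thesis
      by (intro represents_unique[OF represents_bounded_linear[OF J] represents_signed_integral f]
          vm_bounded_linear[OF \<mu>])
  qed
  then show "\<forall>l::'v \<Rightarrow> real. linear l \<longrightarrow> l (?J f) = signed_integral (\<lambda>A. l (\<mu> A)) f" by blast
  \<comment> \<open>The coordinate functionals \<open>r b\<close> are among the functionals tested,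
    and they determine \<open>v\<close>.\<close>
  fix v assume "\<forall>l::'v \<Rightarrow> real. linear l \<longrightarrow> l v = signed_integral (\<lambda>A. l (\<mu> A)) f"
  then have "r b v = signed_integral (\<lambda>A. r b (\<mu> A)) f" for b
    using bounded_linear.linear[OF B(2)] by blast
  then show "v = ?J f" using B(3)[of v] by simp
qed

lemma represents_vm_integral: "represents (vm_integral \<mu>) \<mu>"
proof -
  obtain B and r :: "'v \<Rightarrow> 'v \<Rightarrow> real" where B: "finite B" "\<And>b. bounded_linear (r b)"
    "\<And>v. (\<Sum>b\<in>B. r b v *\<^sub>R b) = v"
    by (rule finite_dim_coordinates[OF fd]) blast
  show ?thesis
    by (rule represents_cong[OF represents_coordinates[OF B] vm_integral_eq[OF B]])
qed

end

section \<open>A dominating positive measure, and the total variation\<close>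

lemma finite_measure_sum:
  fixes M :: "'i \<Rightarrow> 'a::topological_space measure"
  assumes "finite I" "\<And>i. i \<in> I \<Longrightarrow> finite_measure (M i)" "\<And>i. i \<in> I \<Longrightarrow> sets (M i) = sets borel"
  obtains \<tau> where "finite_measure \<tau>" "sets \<tau> = sets borel"
    "\<And>f. f \<in> bounded_borel \<Longrightarrow> (\<integral>x. f x \<partial>\<tau>) = (\<Sum>i\<in>I. \<integral>x. f x \<partial>M i)"
proof -
  define \<tau> where "\<tau> = measure_of UNIV (sets borel) (\<lambda>A. \<Sum>i\<in>I. emeasure (M i) A)"
  have \<tau>: "sets \<tau> = sets borel" "space \<tau> = UNIV"
    using sets.sigma_sets_eq[of borel] sets.space_closed[of borel] by (simp_all add: \<tau>_def)
  have em: "emeasure \<tau> A = (\<Sum>i\<in>I. emeasure (M i) A)" if "A \<in> sets borel" for A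
    unfolding \<tau>_def
  proof (rule emeasure_measure_of_sigma[OF _ _ _ that])
    show "sigma_algebra (UNIV :: 'a set) (sets borel)"
      using sets.sigma_algebra_axioms[of borel] by simp
    show "positive (sets borel) (\<lambda>A. \<Sum>i\<in>I. emeasure (M i) A)" by (simp add: positive_def)
    show "countably_additive (sets borel) (\<lambda>A. \<Sum>i\<in>I. emeasure (M i) A)"
    proof (rule countably_additiveI)
      fix A :: "nat \<Rightarrow> 'a set" assume A: "range A \<subseteq> sets borel" "disjoint_family A"
      have "(\<Sum>n. \<Sum>i\<in>I. emeasure (M i) (A n)) = (\<Sum>i\<in>I. \<Sum>n. emeasure (M i) (A n))"
        by (rule suminf_sum) simp
      also have "\<dots> = (\<Sum>i\<in>I. emeasure (M i) (\<Union> (range A)))"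
        using A assms(3) by (intro sum.cong refl suminf_emeasure) auto
      finally show "(\<Sum>n. \<Sum>i\<in>I. emeasure (M i) (A n)) = (\<Sum>i\<in>I. emeasure (M i) (\<Union> (range A)))" .
    qed
  qed
  have fin: "emeasure (M i) A < top" if "i \<in> I" for i A
    using finite_measure.emeasure_finite[OF assms(2)[OF that], of A] by (simp add: less_top)
  have fm: "finite_measure \<tau>"
    using fin by (intro finite_measureI) (auto simp: \<tau>(2) em assms(1) less_top)
  have "measure \<tau> A = (\<Sum>i\<in>I. measure (M i) A)" if "A \<in> sets borel" for A
    using enn2real_sum[of I "\<lambda>i. emeasure (M i) A"] fin by (simp add: measure_def em[OF that] o_def)
  then have "represents (\<lambda>f. \<integral>x. f x \<partial>\<tau>) (\<lambda>A. \<Sum>i\<in>I. measure (M i) A)"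
    by (rule represents_measure_cong[OF represents_lebesgue_integral[OF fm \<tau>(1)]])
  moreover have "represents (\<lambda>f. \<Sum>i\<in>I. \<integral>x. f x \<partial>M i) (\<lambda>A. \<Sum>i\<in>I. measure (M i) A)"
    using assms by (intro represents_lincomb[where L="\<lambda>_ x. x"] represents_lebesgue_integral bounded_linear_ident)
  \<comment> \<open>Both functionals represent the same set function, so no separate argument about
    integrals against a sum of measures is required.\<close>
  ultimately show ?thesis using represents_unique that[OF fm \<tau>(1)] by blast
qed

text \<open>A substitute for integration against the variation measure: \<open>\<tau>\<close> is the
  sum of the Jordan parts of all coordinates. The loss of a constant factor \<open>c\<close> is
  harmless, since \<open>\<tau>\<close> is used only to make errors small and to show that
  variations are finite.\<close>

lemma vm_integral_dominated:
  fixes \<mu> :: "'a::topological_space set \<Rightarrow> 'v::real_normed_vector"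
  assumes fd: "finite_dim_space TYPE('v)" and \<mu>: "borel_vector_measure \<mu>"
  obtains \<tau> c where "finite_measure \<tau>" "sets \<tau> = sets borel" "c > 0"
    "\<And>f. f \<in> bounded_borel \<Longrightarrow> norm (vm_integral \<mu> f) \<le> c * (\<integral>x. \<bar>f x\<bar> \<partial>\<tau>)"
proof -
  obtain B and r :: "'v \<Rightarrow> 'v \<Rightarrow> real" where B: "finite B" "\<And>b. bounded_linear (r b)"
    "\<And>v. (\<Sum>b\<in>B. r b v *\<^sub>R b) = v"
    by (rule finite_dim_coordinates[OF fd]) blast
  let ?\<nu> = "\<lambda>b A. r b (\<mu> A)"
  let ?M = "\<lambda>(b, s). if s then jordan_pos (?\<nu> b) else jordan_neg (?\<nu> b)"
  have \<nu>: "borel_vector_measure (?\<nu> b)" for b by (rule vm_bounded_linear[OF \<mu> B(2)])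
  obtain \<tau> where \<tau>: "finite_measure \<tau>" "sets \<tau> = sets borel"
    "\<And>f. f \<in> bounded_borel \<Longrightarrow> (\<integral>x. f x \<partial>\<tau>) = (\<Sum>i\<in>B \<times> UNIV. \<integral>x. f x \<partial>?M i)"
    by (rule finite_measure_sum[of "B \<times> UNIV" ?M])
      (use B(1) \<nu> in \<open>auto simp: finite_measure_jordan_pos finite_measure_jordan_neg sets_jordan_pos sets_jordan_neg split: if_splits\<close>)
  \<comment> \<open>The summand 1 keeps \<open>c\<close> positive when the basis is empty.\<close>
  define c where "c = 1 + (\<Sum>b\<in>B. norm b)"
  have c: "c > 0" "norm b \<le> c" if "b \<in> B" for b
    using sum_nonneg[of B norm] member_le_sum[of b B norm] that B(1) by (auto simp: c_def)
  have c0: "c > 0" using sum_nonneg[of B norm] by (simp add: c_def add_pos_nonneg)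
  have "norm (vm_integral \<mu> f) \<le> c * (\<integral>x. \<bar>f x\<bar> \<partial>\<tau>)" if f: "f \<in> bounded_borel" for f
  proof -
    have "norm (vm_integral \<mu> f) \<le> (\<Sum>b\<in>B. norm (signed_integral (?\<nu> b) f *\<^sub>R b))"
      unfolding vm_integral_eq[OF fd \<mu> B f] by (rule norm_sum)
    also have "\<dots> \<le> (\<Sum>b\<in>B. c * ((\<integral>x. \<bar>f x\<bar> \<partial>jordan_pos (?\<nu> b)) + (\<integral>x. \<bar>f x\<bar> \<partial>jordan_neg (?\<nu> b))))"
    proof (rule sum_mono)
      fix b assume "b \<in> B"
      then have "\<bar>signed_integral (?\<nu> b) f\<bar> * norm b \<le>
          ((\<integral>x. \<bar>f x\<bar> \<partial>jordan_pos (?\<nu> b)) + (\<integral>x. \<bar>f x\<bar> \<partial>jordan_neg (?\<nu> b))) * c"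
        using c by (intro mult_mono abs_signed_integral_le) auto
      then show "norm (signed_integral (?\<nu> b) f *\<^sub>R b) \<le>
          c * ((\<integral>x. \<bar>f x\<bar> \<partial>jordan_pos (?\<nu> b)) + (\<integral>x. \<bar>f x\<bar> \<partial>jordan_neg (?\<nu> b)))"
        by (simp add: mult.commute)
    qed
    also have "\<dots> = c * (\<Sum>i\<in>B \<times> UNIV. \<integral>x. \<bar>f x\<bar> \<partial>?M i)"
      by (simp add: sum_distrib_left sum.cartesian_product' UNIV_bool add.commute)
    also have "\<dots> = c * (\<integral>x. \<bar>f x\<bar> \<partial>\<tau>)" using \<tau>(3)[OF bounded_borel_abs[OF f]] by simp
    finally show ?thesis .
  qed
  with \<tau>(1,2) c0 show ?thesis by (rule that)
qed

text \<open>The point is that the set under the real-valued \<open>Sup\<close> is bounded above,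
  namely by \<open>c\<close> times the total mass of the dominating measure.\<close>

lemma total_variation_upper:
  fixes \<mu> :: "'a::topological_space set \<Rightarrow> 'v::real_normed_vector"
  assumes fd: "finite_dim_space TYPE('v)" and \<mu>: "borel_vector_measure \<mu>"
    and E: "\<And>i. i < (m::nat) \<Longrightarrow> E i \<in> sets borel" "disjoint_family_on E {..<m}"
  shows "(\<Sum>i<m. norm (\<mu> (E i))) \<le> total_variation \<mu> UNIV"
proof -
  obtain \<tau> c where \<tau>: "finite_measure \<tau>" "sets \<tau> = sets borel" "c > 0"
    "\<And>f. f \<in> bounded_borel \<Longrightarrow> norm (vm_integral \<mu> f) \<le> c * (\<integral>x. \<bar>f x\<bar> \<partial>\<tau>)"
    by (rule vm_integral_dominated[OF fd \<mu>]) blast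
  interpret finite_measure \<tau> by fact
  have bound: "(\<Sum>i<n. norm (\<mu> (F i))) \<le> c * measure \<tau> (space \<tau>)"
    if F: "\<forall>i<n. F i \<in> sets borel" "disjoint_family_on F {..<n}" for n :: nat and F
  proof -
    have "norm (\<mu> (F i)) \<le> c * measure \<tau> (F i)" if "i < n" for i
    proof -
      have Fi: "F i \<in> sets borel" using F(1) that by blast
      show ?thesis
        using \<tau>(4)[OF bounded_borel_indicator[OF Fi]]
          represents_indicator[OF represents_vm_integral[OF fd \<mu>] Fi] Fi \<tau>(2) by simp
    qed
    then have "(\<Sum>i<n. norm (\<mu> (F i))) \<le> c * (\<Sum>i<n. measure \<tau> (F i))"
      unfolding sum_distrib_left by (intro sum_mono) simp
    also have "(\<Sum>i<n. measure \<tau> (F i)) = measure \<tau> (\<Union>i<n. F i)"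
      using F \<tau>(2) by (intro finite_measure_finite_Union[symmetric]) auto
    also have "c * \<dots> \<le> c * measure \<tau> (space \<tau>)"
      using \<tau>(3) by (intro mult_left_mono bounded_measure) auto
    finally show ?thesis .
  qed
  show ?thesis
    unfolding total_variation_def
  proof (rule cSup_upper)
    show "bdd_above {\<Sum>i<m. norm (\<mu> (E i)) |(m::nat) E. (\<forall>i<m. E i \<in> sets borel \<and> E i \<subseteq> UNIV) \<and> disjoint_family_on E {..<m}}"
      by (rule bdd_aboveI[of _ "c * measure \<tau> (space \<tau>)"]) (clarify, rule bound, blast+)
  qed (use E in blast)
qed

lemma total_variation_approx:
  fixes \<mu> :: "'a::topological_space set \<Rightarrow> 'v::real_normed_vector"
  assumes "y < total_variation \<mu> UNIV"
  obtains m :: nat and E where "\<And>i. i < m \<Longrightarrow> E i \<in> sets borel" "disjoint_family_on E {..<m}"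
    "y < (\<Sum>i<m. norm (\<mu> (E i)))"
proof -
  let ?S = "{\<Sum>i<m. norm (\<mu> (E i)) |(m::nat) E. (\<forall>i<m. E i \<in> sets borel \<and> E i \<subseteq> UNIV) \<and> disjoint_family_on E {..<m}}"
  have "(\<Sum>i<(0::nat). norm (\<mu> {})) \<in> ?S" by (intro CollectI exI[of _ 0] exI[of _ "\<lambda>_. {}"]) (auto simp: disjoint_family_on_def)
  then have "?S \<noteq> {}" by blast
  from less_cSupE[OF assms[unfolded total_variation_def] this]
  obtain x where x: "x \<in> ?S" "y < x" .
  from x(1) obtain m :: nat and E where "x = (\<Sum>i<m. norm (\<mu> (E i)))" "\<forall>i<m. E i \<in> sets borel"
    "disjoint_family_on E {..<m}"
    by auto
  then show ?thesis using x(2) by (intro that[of m E]) auto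
qed

section \<open>Approximation by compactly supported functions\<close>

lemma CcI:
  assumes "continuous_on UNIV \<phi>" "compact K" "\<And>x. \<phi> x \<noteq> 0 \<Longrightarrow> x \<in> K"
  shows "\<phi> \<in> (Cc :: ('a::metric_space \<Rightarrow> real) set)"
proof -
  have "closure {x. \<phi> x \<noteq> 0} \<subseteq> K"
    using assms by (intro closure_minimal compact_imp_closed) auto
  then have "K \<inter> closure {x. \<phi> x \<noteq> 0} = closure {x. \<phi> x \<noteq> 0}" by blast
  moreover have "compact (K \<inter> closure {x. \<phi> x \<noteq> 0})"
    using assms(2) by (intro compact_Int_closed) auto
  ultimately show ?thesis using assms(1) by (simp add: Cc_def)
qed

lemma CcE:
  assumes "\<phi> \<in> Cc"
  obtains K where "continuous_on UNIV \<phi>" "compact K" "{x. \<phi> x \<noteq> 0} \<subseteq> K"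
  using assms closure_subset[of "{x. \<phi> x \<noteq> 0}"] by (auto simp: Cc_def)

lemma Cc_bounded_borel:
  assumes "\<phi> \<in> (Cc :: ('a::metric_space \<Rightarrow> real) set)"
  shows "\<phi> \<in> bounded_borel"
proof -
  obtain K where K: "continuous_on UNIV \<phi>" "compact K" "{x. \<phi> x \<noteq> 0} \<subseteq> K"
    using assms by (rule CcE)
  have "compact (\<phi> ` K)"
    using K(1,2) by (intro compact_continuous_image) (auto intro: continuous_on_subset)
  then have "bounded (insert 0 (\<phi> ` K))" by (simp add: compact_imp_bounded)
  then have "bounded (range \<phi>)" by (rule bounded_subset) (use K(3) in auto)
  moreover have "\<phi> \<in> borel_measurable borel" using K(1) by (rule borel_measurable_continuous_onI)
  ultimately show ?thesis by (simp add: bounded_borel_def)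
qed

lemma Cc_subsupport:
  assumes "\<phi> \<in> (Cc :: ('a::metric_space \<Rightarrow> real) set)" "continuous_on UNIV \<psi>" "\<And>x. \<phi> x = 0 \<Longrightarrow> \<psi> x = 0"
  shows "\<psi> \<in> Cc"
proof -
  obtain K where "compact K" "{x. \<phi> x \<noteq> 0} \<subseteq> K" using assms(1) by (rule CcE) blast
  then show ?thesis using assms(2,3) by (intro CcI[of \<psi> K]) auto
qed

lemma Cc_continuous: "\<phi> \<in> Cc \<Longrightarrow> continuous_on UNIV \<phi>"
  by (simp add: Cc_def)

lemma Cc_zero: "(\<lambda>x. 0) \<in> (Cc :: ('a::metric_space \<Rightarrow> real) set)"
  by (rule CcI[of _ "{}"]) auto

lemma Cc_add:
  assumes "\<phi> \<in> (Cc :: ('a::metric_space \<Rightarrow> real) set)" "\<psi> \<in> Cc"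
  shows "(\<lambda>x. \<phi> x + \<psi> x) \<in> Cc"
proof -
  obtain K where K: "compact K" "{x. \<phi> x \<noteq> 0} \<subseteq> K" using assms(1) by (rule CcE) blast
  obtain L where L: "compact L" "{x. \<psi> x \<noteq> 0} \<subseteq> L" using assms(2) by (rule CcE) blast
  have "x \<in> K \<union> L" if "\<phi> x + \<psi> x \<noteq> 0" for x
    using K(2) L(2) that by (cases "\<phi> x = 0") auto
  moreover have "compact (K \<union> L)" using K(1) L(1) by (rule compact_Un)
  moreover have "continuous_on UNIV (\<lambda>x. \<phi> x + \<psi> x)"
    using assms by (intro continuous_on_add Cc_continuous)
  ultimately show ?thesis by (intro CcI[of _ "K \<union> L"])
qed

lemma Cc_cmult:
  assumes "\<phi> \<in> (Cc :: ('a::metric_space \<Rightarrow> real) set)"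
  shows "(\<lambda>x. c * \<phi> x) \<in> Cc"
  by (rule Cc_subsupport[OF assms]) (simp_all add: continuous_on_mult_left Cc_continuous[OF assms])

lemma Cc_diff:
  assumes "\<phi> \<in> (Cc :: ('a::metric_space \<Rightarrow> real) set)" "\<psi> \<in> Cc"
  shows "(\<lambda>x. \<phi> x - \<psi> x) \<in> Cc"
  using Cc_add[OF assms(1) Cc_cmult[OF assms(2), of "-1"]] by simp

lemma Cc_sum:
  "(\<And>i. i \<in> I \<Longrightarrow> \<phi> i \<in> (Cc :: ('a::metric_space \<Rightarrow> real) set)) \<Longrightarrow> (\<lambda>x. \<Sum>i\<in>I. \<phi> i x) \<in> Cc"
  by (induction I rule: infinite_finite_induct) (auto simp: Cc_zero Cc_add)

text \<open>Local compactness and separability enter here. Countably many balls, with centres in a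
  dense set and radii \<open>1 / (j + 1)\<close>, suffice to cover \<open>U\<close> by balls
  contained in compact subsets of \<open>U\<close>; the functions are built from tents over these
  balls.\<close>

lemma open_set_Cc_limit:
  fixes U :: "'a::metric_space set"
  assumes lc: "locally compact (UNIV :: 'a set)" and sep: "separable_space TYPE('a)" and U: "open U"
  obtains \<phi> where "\<And>n::nat. \<phi> n \<in> Cc" "\<And>n x. 0 \<le> \<phi> n x" "\<And>n x. \<phi> n x \<le> 1"
    "\<And>x. (\<lambda>n. \<phi> n x) \<longlonglongrightarrow> indicator U x"
proof -
  obtain D :: "'a set" where D: "countable D" "closure D = UNIV"
    using sep by (auto simp: separable_space_def)
  then have "D \<noteq> {}" by auto
  define c where "c n = from_nat_into D (fst (prod_decode n))" for n
  define \<rho> where "\<rho> n = 1 / real (Suc (snd (prod_decode n)))" for n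
  define good where "good n \<longleftrightarrow> (\<exists>K. compact K \<and> ball (c n) (\<rho> n) \<subseteq> K \<and> K \<subseteq> U)" for n
  define g where "g n y = (if good n then max 0 (\<rho> n - dist (c n) y) else 0)" for n y
  \<comment> \<open>The finite sum keeps the support compact; the factor \<open>real n\<close> lifts
    every positive value above 1 in the end, so that the cap gives exactly 1 from some index on at
    each point of \<open>U\<close>.\<close>
  define \<phi> where "\<phi> n y = min 1 (real n * (\<Sum>i<n. g i y))" for n y
  have g0: "0 \<le> g n y" for n y by (simp add: g_def)
  have gball: "good n \<and> y \<in> ball (c n) (\<rho> n)" if "g n y \<noteq> 0" for n y
    using that by (auto simp: g_def split: if_splits)
  have "\<forall>n. \<exists>K. good n \<longrightarrow> compact K \<and> ball (c n) (\<rho> n) \<subseteq> K \<and> K \<subseteq> U"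
    by (auto simp: good_def)
  from choice[OF this] obtain K where
    K: "\<And>n. good n \<Longrightarrow> compact (K n)" "\<And>n. good n \<Longrightarrow> ball (c n) (\<rho> n) \<subseteq> K n" "\<And>n. good n \<Longrightarrow> K n \<subseteq> U"
    by auto
  have gK: "y \<in> K n \<and> good n" if "g n y \<noteq> 0" for n y using gball[OF that] K(2) by blast
  have gcont: "continuous_on UNIV (g n)" for n
    unfolding g_def[abs_def] by (cases "good n") (auto intro!: continuous_intros)
  have "\<phi> n \<in> Cc" for n
  proof (rule CcI)
    show "continuous_on UNIV (\<phi> n)"
      unfolding \<phi>_def[abs_def] by (intro continuous_intros gcont)
    show "compact (\<Union>i\<in>{i\<in>{..<n}. good i}. K i)" by (intro compact_UN) (auto simp: K)
    fix x assume "\<phi> n x \<noteq> 0"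
    then have "(\<Sum>i<n. g i x) \<noteq> 0" by (auto simp: \<phi>_def)
    then obtain i where "i < n" "g i x \<noteq> 0" by (meson lessThan_iff sum.neutral)
    then show "x \<in> (\<Union>i\<in>{i\<in>{..<n}. good i}. K i)" using gK by auto
  qed
  moreover have "0 \<le> \<phi> n x" "\<phi> n x \<le> 1" for n x
    by (auto simp: \<phi>_def intro!: sum_nonneg mult_nonneg_nonneg g0)
  moreover have "(\<lambda>n. \<phi> n x) \<longlonglongrightarrow> indicator U x" for x
  proof (cases "x \<in> U")
    case False
    then have "g i x = 0" for i using gK[of i x] K(3)[of i] by blast
    then have "\<phi> n x = 0" for n by (simp add: \<phi>_def)
    then show ?thesis using False by simp
  next
    case True
    have "openin (top_of_set UNIV) U" using U by simp
    from locallyE[OF lc this True]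
    obtain u v where uv: "openin (top_of_set UNIV) u" "compact v" "x \<in> u" "u \<subseteq> v" "v \<subseteq> U" .
    then obtain e where e: "e > 0" "ball x e \<subseteq> u" by (auto simp: open_contains_ball)
    \<comment> \<open>A radius below \<open>e / 2\<close> and a centre closer to \<open>x\<close>
      than that radius give a ball that contains \<open>x\<close> and stays inside
      \<open>ball x e\<close>.\<close>
    obtain j where j: "1 / real (Suc j) < e / 2"
      using reals_Archimedean[of "e / 2"] e(1) by (auto simp: inverse_eq_divide)
    have "x \<in> closure D" using D by simp
    then have "\<exists>d\<in>D. dist d x < 1 / real (Suc j)"
      unfolding closure_approachable by (elim allE impE) auto
    then obtain d where d: "d \<in> D" "dist d x < 1 / real (Suc j)" by blast
    obtain i where i: "d = from_nat_into D i" using from_nat_into_surj[OF D(1) d(1)] by metis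
    define n0 where "n0 = prod_encode (i, j)"
    have n0: "c n0 = d" "\<rho> n0 = 1 / real (Suc j)" by (auto simp: n0_def c_def \<rho>_def i)
    have "ball d (1 / real (Suc j)) \<subseteq> ball x e"
    proof
      fix y assume "y \<in> ball d (1 / real (Suc j))"
      then have "dist d y < e / 2" using j by simp
      moreover have "dist x d < e / 2" using d(2) j by (simp add: dist_commute)
      ultimately show "y \<in> ball x e" using dist_triangle[of x y d] by simp
    qed
    then have "good n0" unfolding good_def n0 using uv e(2) by (intro exI[of _ v]) blast
    then have gp: "g n0 x > 0" using d(2) by (simp add: g_def n0)
    obtain N where N: "real N * g n0 x > 1" using reals_Archimedean3[OF gp] by blast
    \<comment> \<open>\<open>Suc n0\<close> brings the tent of index \<open>n0\<close> into the sum,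
      and \<open>N\<close> makes the factor large enough.\<close>
    have "\<phi> n x = 1" if "n \<ge> max N (Suc n0)" for n
    proof -
      have "real N * g n0 x \<le> real n * (\<Sum>i<n. g i x)"
        using that g0 by (intro mult_mono member_le_sum) auto
      then show ?thesis using N by (simp add: \<phi>_def)
    qed
    then have "\<forall>\<^sub>F n in sequentially. \<phi> n x = 1" unfolding eventually_sequentially by blast
    then show ?thesis using True by (simp add: tendsto_eventually)
  qed
  ultimately show ?thesis using that by blast
qed

text \<open>No bounds on the values of \<open>\<phi>\<close> are imposed, so that differences and
  sums of approximants remain admissible; the values are corrected later by clamping and
  normalising.\<close>

definition Cc_approx :: "'a::metric_space measure \<Rightarrow> 'a set \<Rightarrow> bool" where
  "Cc_approx \<tau> A \<longleftrightarrow> (\<forall>e>0. \<exists>\<phi>\<in>Cc. (\<integral>x. \<bar>\<phi> x - indicator A x\<bar> \<partial>\<tau>) < e)"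

context
  fixes \<tau> :: "'a::metric_space measure"
  assumes fm: "finite_measure \<tau>" and sets_\<tau>: "sets \<tau> = sets borel"
begin

lemma bounded_borel_integral_mono:
  "f \<in> bounded_borel \<Longrightarrow> g \<in> bounded_borel \<Longrightarrow> (\<And>x. f x \<le> g x) \<Longrightarrow> (\<integral>x. f x \<partial>\<tau>) \<le> (\<integral>x. g x \<partial>\<tau>)"
  by (intro integral_mono integrable_bounded_borel[OF fm sets_\<tau>])

lemma bounded_borel_integral_add:
  "f \<in> bounded_borel \<Longrightarrow> g \<in> bounded_borel \<Longrightarrow> (\<integral>x. f x + g x \<partial>\<tau>) = (\<integral>x. f x \<partial>\<tau>) + (\<integral>x. g x \<partial>\<tau>)"
  by (rule represents_add[OF represents_lebesgue_integral[OF fm sets_\<tau>]])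

lemma bounded_borel_integral_sum:
  "(\<And>i. i \<in> I \<Longrightarrow> f i \<in> bounded_borel) \<Longrightarrow> (\<integral>x. (\<Sum>i\<in>I. f i x) \<partial>\<tau>) = (\<Sum>i\<in>I. \<integral>x. f i x \<partial>\<tau>)"
  by (rule represents_sum[OF represents_lebesgue_integral[OF fm sets_\<tau>]])

lemma bounded_borel_integral_null:
  assumes f: "\<And>n::nat. f n \<in> bounded_borel" and le: "\<And>n x. \<bar>f n x\<bar> \<le> K" and lim: "\<And>x. (\<lambda>n. f n x) \<longlonglongrightarrow> 0"
  shows "(\<lambda>n. \<integral>x. \<bar>f n x\<bar> \<partial>\<tau>) \<longlonglongrightarrow> 0"
proof -
  have m: "(\<lambda>x. \<bar>f n x\<bar>) \<in> borel_measurable \<tau>" for n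
    using bounded_borel_measurable[OF bounded_borel_abs[OF f]]
    by (simp add: measurable_cong_sets[OF sets_\<tau> refl])
  have "(\<lambda>n. \<integral>x. \<bar>f n x\<bar> \<partial>\<tau>) \<longlonglongrightarrow> (\<integral>x. 0 \<partial>\<tau>)"
  proof (rule integral_dominated_convergence[where w="\<lambda>_. K"])
    show "integrable \<tau> (\<lambda>_. K)"
      by (rule integrable_bounded_borel[OF fm sets_\<tau> bounded_borel_const])
    show "AE x in \<tau>. (\<lambda>n. \<bar>f n x\<bar>) \<longlonglongrightarrow> 0"
      using lim by (intro AE_I2) (simp add: tendsto_rabs_zero)
  qed (use m le in auto)
  then show ?thesis by simp
qed

lemma Cc_approx_diff_bb:
  fixes \<phi> :: "'a \<Rightarrow> real"
  shows "\<phi> \<in> Cc \<Longrightarrow> A \<in> sets borel \<Longrightarrow> (\<lambda>x. \<bar>\<phi> x - indicator A x\<bar>) \<in> bounded_borel"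
  by (intro bounded_borel_abs bounded_borel_diff Cc_bounded_borel bounded_borel_indicator)

text \<open>A Dynkin-system argument: open sets are an intersection-stable generator, and the
  approximable sets are closed under complements and countable disjoint unions.\<close>

lemma Cc_approx_borel:
  assumes lc: "locally compact (UNIV :: 'a set)" and sep: "separable_space TYPE('a)" and A: "A \<in> sets borel"
  shows "Cc_approx \<tau> A"
proof -
  have op: "Cc_approx \<tau> U" if U: "open U" for U
    unfolding Cc_approx_def
  proof (intro allI impI)
    fix e :: real assume e: "e > 0"
    obtain \<phi> where \<phi>: "\<And>n::nat. \<phi> n \<in> Cc" "\<And>n x. 0 \<le> \<phi> n x" "\<And>n x. \<phi> n x \<le> 1"
      "\<And>x. (\<lambda>n. \<phi> n x) \<longlonglongrightarrow> indicator U x"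
      by (rule open_set_Cc_limit[OF lc sep U]) blast
    have "(\<lambda>n. \<integral>x. \<bar>\<phi> n x - indicator U x\<bar> \<partial>\<tau>) \<longlonglongrightarrow> 0"
    proof (rule bounded_borel_integral_null)
      show "(\<lambda>x. \<phi> n x - indicator U x) \<in> bounded_borel" for n
        using U by (intro bounded_borel_diff Cc_bounded_borel \<phi> bounded_borel_indicator) auto
      show "\<bar>\<phi> n x - indicator U x\<bar> \<le> 1" for n x
        using \<phi>(2,3)[of n x] by (auto simp: indicator_def)
      show "(\<lambda>n. \<phi> n x - indicator U x) \<longlonglongrightarrow> 0" for x using \<phi>(4) by (simp add: LIM_zero)
    qed
    then have "\<forall>\<^sub>F n in sequentially. (\<integral>x. \<bar>\<phi> n x - indicator U x\<bar> \<partial>\<tau>) < e"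
      using e by (rule order_tendstoD)
    then obtain n where "(\<integral>x. \<bar>\<phi> n x - indicator U x\<bar> \<partial>\<tau>) < e"
      by (auto simp: eventually_sequentially)
    then show "\<exists>\<phi>\<in>Cc. (\<integral>x. \<bar>\<phi> x - indicator U x\<bar> \<partial>\<tau>) < e" using \<phi>(1) by blast
  qed
  have "Int_stable {S :: 'a set. open S}" by (auto simp: Int_stable_def)
  moreover have "{S :: 'a set. open S} \<subseteq> Pow UNIV" by simp
  moreover have "A \<in> sigma_sets UNIV {S. open S}" using A by (simp add: sets_borel)
  ultimately show ?thesis
  proof (induction rule: sigma_sets_induct_disjoint)
    case (basic A)
    then show ?case using op by simp
  next
    case empty
    show ?case using op by simp
  next
    case (compl A)
    then have A: "A \<in> sets borel" by (simp add: sets_borel)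
    show ?case
      unfolding Cc_approx_def
    proof (intro allI impI)
      fix e :: real assume "e > 0"
      \<comment> \<open>The constant 1 need not have compact support, so the complement is
        approximated by subtracting from an approximant \<open>\<psi>\<close> of the whole
        space.\<close>
      then obtain \<phi> \<psi> where \<phi>: "\<phi> \<in> Cc" "(\<integral>x. \<bar>\<phi> x - indicator A x\<bar> \<partial>\<tau>) < e / 2"
        and \<psi>: "\<psi> \<in> Cc" "(\<integral>x. \<bar>\<psi> x - indicator UNIV x\<bar> \<partial>\<tau>) < e / 2"
        using compl(2) op[of UNIV] unfolding Cc_approx_def by (meson half_gt_zero open_UNIV)
      have "(\<integral>x. \<bar>(\<psi> x - \<phi> x) - indicator (UNIV - A) x\<bar> \<partial>\<tau>) \<le>
          (\<integral>x. \<bar>\<psi> x - indicator UNIV x\<bar> + \<bar>\<phi> x - indicator A x\<bar> \<partial>\<tau>)"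
        using A by (intro bounded_borel_integral_mono bounded_borel_add Cc_approx_diff_bb Cc_diff \<phi> \<psi>)
          (auto simp: indicator_def)
      also have "\<dots> = (\<integral>x. \<bar>\<psi> x - indicator UNIV x\<bar> \<partial>\<tau>) + (\<integral>x. \<bar>\<phi> x - indicator A x\<bar> \<partial>\<tau>)"
        using A by (intro bounded_borel_integral_add Cc_approx_diff_bb \<phi> \<psi>) auto
      also have "\<dots> < e" using \<phi>(2) \<psi>(2) by linarith
      finally show "\<exists>\<phi>\<in>Cc. (\<integral>x. \<bar>\<phi> x - indicator (UNIV - A) x\<bar> \<partial>\<tau>) < e"
        using Cc_diff[OF \<psi>(1) \<phi>(1)] by (rule bexI)
    qed
  next
    case (union A)
    then have A: "A i \<in> sets borel" for i by (auto simp: sets_borel)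
    let ?U = "\<Union>i. A i"
    have U: "?U \<in> sets borel" using A by auto
    have ind: "(\<lambda>x. \<Sum>i<n. indicator (A i) x :: real) \<in> bounded_borel" for n
      by (intro bounded_borel_sum bounded_borel_indicator A)
    have indU: "(\<Sum>i<n. indicator (A i) x :: real) = indicator (\<Union>i<n. A i) x" for n x
      using union(1) by (intro indicator_UN_disjoint[symmetric]) (auto simp: disjoint_family_on_def)
    have lim: "(\<lambda>n. \<integral>x. \<bar>(\<Sum>i<n. indicator (A i) x) - indicator ?U x :: real\<bar> \<partial>\<tau>) \<longlonglongrightarrow> 0"
    proof (rule bounded_borel_integral_null[where K=1])
      show "(\<lambda>x. (\<Sum>i<n. indicator (A i) x) - indicator ?U x :: real) \<in> bounded_borel" for n
        by (intro bounded_borel_diff ind bounded_borel_indicator U)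
      show "\<bar>(\<Sum>i<n. indicator (A i) x) - indicator ?U x\<bar> \<le> (1::real)" for n x
        unfolding indU by (auto simp: indicator_def)
      fix x
      have "\<forall>\<^sub>F n in sequentially. (\<Sum>i<n. indicator (A i) x) - indicator ?U x = (0::real)"
      proof (cases "x \<in> ?U")
        case True
        then obtain i where "x \<in> A i" by blast
        then show ?thesis
          unfolding eventually_sequentially indU by (intro exI[of _ "Suc i"]) (auto simp: indicator_def)
      qed (simp add: indU indicator_def)
      then show "(\<lambda>n. (\<Sum>i<n. indicator (A i) x) - indicator ?U x) \<longlonglongrightarrow> (0::real)"
        by (rule tendsto_eventually)
    qed
    show ?case
      unfolding Cc_approx_def
    proof (intro allI impI)
      fix e :: real assume e: "e > 0"
      have "\<forall>\<^sub>F n in sequentially. (\<integral>x. \<bar>(\<Sum>i<n. indicator (A i) x) - indicator ?U x :: real\<bar> \<partial>\<tau>) < e / 2"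
        using e by (intro order_tendstoD[OF lim]) simp
      then obtain n where n: "(\<integral>x. \<bar>(\<Sum>i<n. indicator (A i) x) - indicator ?U x :: real\<bar> \<partial>\<tau>) < e / 2"
        by (auto simp: eventually_sequentially)
      \<comment> \<open>The truncation \<open>n\<close> is already fixed, so the tolerance may
        depend on it: \<open>n\<close> errors add up to at most \<open>e / 2\<close>, and
        \<open>Suc n\<close> covers \<open>n = 0\<close>.\<close>
      have "\<forall>i. \<exists>\<phi>. \<phi> \<in> Cc \<and> (\<integral>x. \<bar>\<phi> x - indicator (A i) x\<bar> \<partial>\<tau>) < e / (2 * real (Suc n))"
        using union(3) e unfolding Cc_approx_def by (metis divide_pos_pos mult_pos_pos of_nat_0_less_iff zero_less_Suc zero_less_numeral)
      from choice[OF this] obtain \<phi> where \<phi>: "\<And>i. \<phi> i \<in> Cc"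
        "\<And>i. (\<integral>x. \<bar>\<phi> i x - indicator (A i) x\<bar> \<partial>\<tau>) < e / (2 * real (Suc n))"
        by blast
      have \<phi>s: "(\<lambda>x. \<Sum>i<n. \<phi> i x) \<in> Cc" by (intro Cc_sum \<phi>)
      have bs: "(\<lambda>x. \<bar>(\<Sum>i<n. indicator (A i) x) - indicator ?U x\<bar>) \<in> bounded_borel"
        by (intro bounded_borel_abs bounded_borel_diff ind bounded_borel_indicator U)
      have "(\<integral>x. \<bar>(\<Sum>i<n. \<phi> i x) - indicator ?U x :: real\<bar> \<partial>\<tau>) \<le>
         (\<integral>x. (\<Sum>i<n. \<bar>\<phi> i x - indicator (A i) x\<bar>) + \<bar>(\<Sum>i<n. indicator (A i) x) - indicator ?U x :: real\<bar> \<partial>\<tau>)"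
      proof (rule bounded_borel_integral_mono)
        show "(\<lambda>x. \<bar>(\<Sum>i<n. \<phi> i x) - indicator ?U x\<bar>) \<in> bounded_borel"
          by (rule Cc_approx_diff_bb[OF \<phi>s U])
        show "(\<lambda>x. (\<Sum>i<n. \<bar>\<phi> i x - indicator (A i) x\<bar>) +
            \<bar>(\<Sum>i<n. indicator (A i) x) - indicator ?U x\<bar>) \<in> bounded_borel"
          by (rule bounded_borel_add[OF bounded_borel_sum[OF Cc_approx_diff_bb[OF \<phi>(1) A]] bs])
        fix x
        have "\<bar>(\<Sum>i<n. \<phi> i x - indicator (A i) x)\<bar> \<le> (\<Sum>i<n. \<bar>\<phi> i x - indicator (A i) x\<bar>)"
          by (rule sum_abs)
        then show "\<bar>(\<Sum>i<n. \<phi> i x) - indicator ?U x\<bar> \<le>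
          (\<Sum>i<n. \<bar>\<phi> i x - indicator (A i) x\<bar>) + \<bar>(\<Sum>i<n. indicator (A i) x) - indicator ?U x\<bar>"
          unfolding sum_subtractf by linarith
      qed
      also have "\<dots> = (\<Sum>i<n. \<integral>x. \<bar>\<phi> i x - indicator (A i) x\<bar> \<partial>\<tau>) +
          (\<integral>x. \<bar>(\<Sum>i<n. indicator (A i) x) - indicator ?U x :: real\<bar> \<partial>\<tau>)"
        by (subst bounded_borel_integral_add)
          (auto intro!: bounded_borel_sum Cc_approx_diff_bb \<phi> A bs bounded_borel_integral_sum)
      also have "\<dots> \<le> (\<Sum>i<n. e / (2 * real (Suc n))) + (\<integral>x. \<bar>(\<Sum>i<n. indicator (A i) x) - indicator ?U x :: real\<bar> \<partial>\<tau>)"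
        using \<phi>(2) by (intro add_right_mono sum_mono less_imp_le)
      also have "(\<Sum>i<n. e / (2 * real (Suc n))) \<le> e / 2"
        using e by (simp add: field_simps)
      finally show "\<exists>\<phi>\<in>Cc. (\<integral>x. \<bar>\<phi> x - indicator ?U x :: real\<bar> \<partial>\<tau>) < e"
        using \<phi>s n by (intro bexI[of _ "\<lambda>x. \<Sum>i<n. \<phi> i x"]) auto
    qed
  qed
qed

text \<open>Approximating each set separately gives no control of the sum. Nonnegativity and sum at
  most 1 are what the comparison with the total variation and the membership of weighted sums in the
  range rely on.\<close>

lemma Cc_partition_approx:
  assumes lc: "locally compact (UNIV :: 'a set)" and sep: "separable_space TYPE('a)"
    and A: "\<And>i. i < (m::nat) \<Longrightarrow> A i \<in> sets borel" "disjoint_family_on A {..<m}" and e: "e > 0"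
  obtains \<phi> where "\<And>i. i < m \<Longrightarrow> \<phi> i \<in> Cc" "\<And>i x. i < m \<Longrightarrow> 0 \<le> \<phi> i x" "\<And>x. (\<Sum>i<m. \<phi> i x) \<le> 1"
    "\<And>i. i < m \<Longrightarrow> (\<integral>x. \<bar>\<phi> i x - indicator (A i) x\<bar> \<partial>\<tau>) < e"
proof -
  \<comment> \<open>The pointwise bound charges the error of index \<open>i\<close> once and then
    the errors of all \<open>m\<close> indices, hence \<open>Suc m\<close> errors in total.\<close>
  define d where "d = e / real (Suc m)"
  have d: "d > 0" using e by (simp add: d_def)
  have "\<exists>\<phi>. \<phi> \<in> Cc \<and> (\<integral>x. \<bar>\<phi> x - indicator (A i) x\<bar> \<partial>\<tau>) < d" if "i < m" for i
    using Cc_approx_borel[OF lc sep A(1)[OF that]] d unfolding Cc_approx_def by blast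
  then have "\<forall>i\<in>{..<m}. \<exists>\<phi>. \<phi> \<in> Cc \<and> (\<integral>x. \<bar>\<phi> x - indicator (A i) x\<bar> \<partial>\<tau>) < d" by blast
  from bchoice[OF this] obtain \<phi>0 where \<phi>0: "\<And>i. i < m \<Longrightarrow> \<phi>0 i \<in> Cc"
    "\<And>i. i < m \<Longrightarrow> (\<integral>x. \<bar>\<phi>0 i x - indicator (A i) x\<bar> \<partial>\<tau>) < d"
    by auto
  define \<phi>1 where "\<phi>1 i x = max 0 (min 1 (\<phi>0 i x))" for i x
  \<comment> \<open>Dividing by \<open>max 1 (\<Sum>i<m. \<phi>1 i x)\<close> costs little in \<open>L\<^sup>1\<close>, since the sum exceeds
    \<open>\<Sum>i<m. indicator (A i) x \<le> 1\<close> only by the approximation errors.\<close>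
  define S where "S x = max 1 (\<Sum>i<m. \<phi>1 i x)" for x
  define \<phi> where "\<phi> i x = \<phi>1 i x / S x" for i x
  have \<phi>1c: "\<phi>1 i \<in> Cc" if "i < m" for i
    unfolding \<phi>1_def[abs_def] using \<phi>0(1)[OF that]
  proof (rule Cc_subsupport)
    show "continuous_on UNIV (\<lambda>x. max 0 (min 1 (\<phi>0 i x)))"
      by (intro continuous_intros Cc_continuous \<phi>0 that)
  qed simp
  have \<phi>1b: "0 \<le> \<phi>1 i x" "\<phi>1 i x \<le> 1" for i x by (auto simp: \<phi>1_def)
  have S1: "S x \<ge> 1" for x by (simp add: S_def)
  have Sc: "continuous_on UNIV S"
    unfolding S_def[abs_def] by (intro continuous_intros Cc_continuous \<phi>1c) auto
  have c1: "\<phi> i \<in> Cc" if i: "i < m" for i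
    unfolding \<phi>_def[abs_def] using \<phi>1c[OF i]
  proof (rule Cc_subsupport)
    have "S x \<noteq> 0" for x using S1[of x] by auto
    then show "continuous_on UNIV (\<lambda>x. \<phi>1 i x / S x)"
      by (intro continuous_on_divide Cc_continuous \<phi>1c i Sc) auto
  qed simp
  have c2: "0 \<le> \<phi> i x" for i x using \<phi>1b(1)[of i x] S1[of x] by (simp add: \<phi>_def)
  have c3: "(\<Sum>i<m. \<phi> i x) \<le> 1" for x
    using S1[of x] by (simp add: \<phi>_def sum_divide_distrib[symmetric]) (simp add: S_def)
  have ptw: "\<bar>\<phi> i x - indicator (A i) x\<bar> \<le> \<bar>\<phi>0 i x - indicator (A i) x\<bar> + (\<Sum>j<m. \<bar>\<phi>0 j x - indicator (A j) x\<bar>)"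
    if i: "i < m" for i x
  proof -
    have cl: "\<bar>\<phi>1 j x - indicator (A j) x\<bar> \<le> \<bar>\<phi>0 j x - indicator (A j) x\<bar>" for j
      by (auto simp: \<phi>1_def indicator_def)
    have "(\<Sum>j<m. indicator (A j) x :: real) = indicator (\<Union>j<m. A j) x"
      using A(2) by (intro indicator_UN_disjoint[symmetric]) auto
    then have i1: "(\<Sum>j<m. indicator (A j) x :: real) \<le> 1" by (simp add: indicator_def)
    have "(\<Sum>j<m. \<phi>1 j x) - (\<Sum>j<m. indicator (A j) x) \<le> (\<Sum>j<m. \<bar>\<phi>0 j x - indicator (A j) x\<bar>)"
      unfolding sum_subtractf[symmetric] by (intro sum_mono) (use cl in \<open>auto simp: abs_le_iff\<close>)
    then have "(\<Sum>j<m. \<phi>1 j x) - 1 \<le> (\<Sum>j<m. \<bar>\<phi>0 j x - indicator (A j) x\<bar>)" using i1 by linarith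
    moreover have "0 \<le> (\<Sum>j<m. \<bar>\<phi>0 j x - indicator (A j) x\<bar>)" by (intro sum_nonneg) auto
    ultimately have S2: "S x - 1 \<le> (\<Sum>j<m. \<bar>\<phi>0 j x - indicator (A j) x\<bar>)"
      unfolding S_def max_def by (cases "1 \<le> (\<Sum>j<m. \<phi>1 j x)") (simp_all only: if_True if_False diff_self)
    have "\<phi>1 i x - \<phi> i x = \<phi> i x * (S x - 1)" using S1[of x] by (simp add: \<phi>_def field_simps)
    also have "\<dots> \<le> 1 * (S x - 1)"
    proof (rule mult_right_mono)
      have "\<phi> i x \<le> (\<Sum>i<m. \<phi> i x)" using i c2 by (intro member_le_sum) auto
      then show "\<phi> i x \<le> 1" using c3[of x] by linarith
    qed (use S1[of x] in simp)
    finally have "\<phi>1 i x - \<phi> i x \<le> S x - 1" by simp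
    moreover have "\<phi> i x \<le> \<phi>1 i x"
      using S1[of x] \<phi>1b(1)[of i x] mult_left_mono[of 1 "S x" "\<phi>1 i x"] by (simp add: \<phi>_def field_simps)
    ultimately show ?thesis using cl[of i] S2 by linarith
  qed
  have c4: "(\<integral>x. \<bar>\<phi> i x - indicator (A i) x\<bar> \<partial>\<tau>) < e" if i: "i < m" for i
  proof -
    have bb: "(\<lambda>x. \<bar>\<phi>0 j x - indicator (A j) x\<bar>) \<in> bounded_borel" if "j < m" for j
      using that by (intro Cc_approx_diff_bb \<phi>0 A)
    have "(\<integral>x. \<bar>\<phi> i x - indicator (A i) x\<bar> \<partial>\<tau>) \<le>
      (\<integral>x. \<bar>\<phi>0 i x - indicator (A i) x\<bar> + (\<Sum>j<m. \<bar>\<phi>0 j x - indicator (A j) x\<bar>) \<partial>\<tau>)"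
      using i by (intro bounded_borel_integral_mono bounded_borel_add bounded_borel_sum bb ptw Cc_approx_diff_bb c1 A) auto
    also have "\<dots> = (\<integral>x. \<bar>\<phi>0 i x - indicator (A i) x\<bar> \<partial>\<tau>) + (\<Sum>j<m. \<integral>x. \<bar>\<phi>0 j x - indicator (A j) x\<bar> \<partial>\<tau>)"
      using i by (subst bounded_borel_integral_add) (auto intro!: bounded_borel_sum bb bounded_borel_integral_sum)
    also have "\<dots> < d + real m * d"
    proof (rule add_less_le_mono)
      show "(\<Sum>j<m. \<integral>x. \<bar>\<phi>0 j x - indicator (A j) x\<bar> \<partial>\<tau>) \<le> real m * d"
        using sum_mono[of "{..<m}" "\<lambda>j. \<integral>x. \<bar>\<phi>0 j x - indicator (A j) x\<bar> \<partial>\<tau>" "\<lambda>_. d"] \<phi>0(2)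
        by (simp add: less_imp_le)
    qed (rule \<phi>0(2)[OF i])
    also have "d + real m * d = real (Suc m) * d" by (simp add: algebra_simps)
    also have "\<dots> = e" by (simp add: d_def del: of_nat_Suc)
    finally show ?thesis .
  qed
  show ?thesis by (rule that[of \<phi>, OF c1 c2 c3 c4])
qed

end

section \<open>Ranges and the Hausdorff distance\<close>

lemma vm_range_superset: "E \<in> sets borel \<Longrightarrow> \<mu> E \<in> vm_range \<mu>"
  unfolding vm_range_def by (intro subsetD[OF closure_subset] hull_inc) blast

lemma vm_range_nonempty: "vm_range \<mu> \<noteq> {}"
  using vm_range_superset[of "{}" \<mu>] by auto

lemma vm_range_least:
  assumes "convex S" "closed S" "\<And>E. E \<in> sets borel \<Longrightarrow> \<mu> E \<in> S"
  shows "vm_range \<mu> \<subseteq> S"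
  unfolding vm_range_def using assms by (intro closure_minimal hull_minimal) auto

lemma closed_vm_range: "closed (vm_range \<mu>)"
  by (simp add: vm_range_def)

lemma convex_vm_range: "convex (vm_range \<mu>)"
  by (simp add: vm_range_def convex_closure convex_convex_hull)

lemma norm_vm_le_total_variation:
  fixes \<mu> :: "'a::topological_space set \<Rightarrow> 'v::real_normed_vector"
  assumes fd: "finite_dim_space TYPE('v)" and \<mu>: "borel_vector_measure \<mu>" and E: "E \<in> sets borel"
  shows "norm (\<mu> E) \<le> total_variation \<mu> UNIV"
  using total_variation_upper[OF fd \<mu>, of 1 "\<lambda>_. E"] E by (simp add: disjoint_family_on_def)

lemma bounded_vm_range:
  fixes \<mu> :: "'a::topological_space set \<Rightarrow> 'v::real_normed_vector"
  assumes fd: "finite_dim_space TYPE('v)" and \<mu>: "borel_vector_measure \<mu>"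
  shows "bounded (vm_range \<mu>)"
proof (rule bounded_subset[OF bounded_cball])
  show "vm_range \<mu> \<subseteq> cball 0 (total_variation \<mu> UNIV)"
    using norm_vm_le_total_variation[OF fd \<mu>] by (intro vm_range_least) auto
qed

lemma infdist_bdd_above:
  fixes A B :: "'v::real_normed_vector set"
  assumes "bounded A" "b \<in> B"
  shows "bdd_above ((\<lambda>a. infdist a B) ` A)"
proof -
  obtain K where "\<And>a. a \<in> A \<Longrightarrow> dist b a \<le> K" using assms(1) bounded_any_center by blast
  then show ?thesis
    using infdist_le[OF assms(2)] by (intro bdd_aboveI2[of _ _ K]) (metis dist_commute order_trans)
qed

lemma hausdorff_distance_nonneg:
  fixes A B :: "'v::real_normed_vector set"
  assumes "bounded A" "A \<noteq> {}" "B \<noteq> {}"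
  shows "0 \<le> hausdorff_distance A B"
proof -
  obtain a b where ab: "a \<in> A" "b \<in> B" using assms by blast
  have "0 \<le> infdist a B" by (rule infdist_nonneg)
  also have "\<dots> \<le> (SUP a\<in>A. infdist a B)"
    using ab by (intro cSUP_upper infdist_bdd_above assms)
  finally show ?thesis by (simp add: hausdorff_distance_def)
qed

lemma hausdorff_distance_le:
  fixes A B :: "'v::real_normed_vector set"
  assumes "A \<noteq> {}" "B \<noteq> {}" "\<And>a. a \<in> A \<Longrightarrow> infdist a B \<le> e" "\<And>b. b \<in> B \<Longrightarrow> infdist b A \<le> e"
  shows "hausdorff_distance A B \<le> e"
  unfolding hausdorff_distance_def using assms by (auto intro!: cSUP_least)

lemma infdist_lessD:
  assumes "infdist x S < e" "S \<noteq> {}"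
  shows "\<exists>a\<in>S. dist x a < e"
  using cInf_lessD[of "dist x ` S" e] assms by (auto simp: infdist_def)

text \<open>Convexity and closedness of this neighbourhood reduce an estimate on a whole range to
  the points \<open>\<mu> E\<close>. The infimum need not be attained, so the proof works with
  near-minimisers and an extra \<open>d > 0\<close>.\<close>

lemma convex_infdist_sublevel:
  fixes S :: "'v::real_normed_vector set"
  assumes "convex S"
  shows "convex {x. infdist x S \<le> e}"
proof (cases "S = {}")
  case True
  then show ?thesis by (cases "0 \<le> e") (auto simp: infdist_def)
next
  case False
  show ?thesis
  proof (rule convexI)
    fix x y and u v :: real
    assume xy: "x \<in> {x. infdist x S \<le> e}" "y \<in> {x. infdist x S \<le> e}" and uv: "0 \<le> u" "0 \<le> v" "u + v = 1"
    have "infdist (u *\<^sub>R x + v *\<^sub>R y) S \<le> e + d" if d: "d > 0" for d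
    proof -
      have "infdist x S < e + d" "infdist y S < e + d" using xy d by auto
      then obtain a b where ab: "a \<in> S" "dist x a < e + d" "b \<in> S" "dist y b < e + d"
        using infdist_lessD[OF _ False] by blast
      have "u *\<^sub>R a + v *\<^sub>R b \<in> S" using assms ab uv by (rule_tac convexD) auto
      then have "infdist (u *\<^sub>R x + v *\<^sub>R y) S \<le> norm ((u *\<^sub>R x + v *\<^sub>R y) - (u *\<^sub>R a + v *\<^sub>R b))"
        by (metis infdist_le dist_norm)
      also have "(u *\<^sub>R x + v *\<^sub>R y) - (u *\<^sub>R a + v *\<^sub>R b) = u *\<^sub>R (x - a) + v *\<^sub>R (y - b)"
        by (simp add: algebra_simps)
      also have "norm \<dots> \<le> u * norm (x - a) + v * norm (y - b)"
        using norm_triangle_ineq[of "u *\<^sub>R (x - a)" "v *\<^sub>R (y - b)"] uv by simp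
      also have "\<dots> \<le> u * (e + d) + v * (e + d)"
        using ab uv by (intro add_mono mult_left_mono) (auto simp: dist_norm)
      also have "\<dots> = e + d" using uv by (simp add: distrib_right[symmetric])
      finally show ?thesis .
    qed
    then show "u *\<^sub>R x + v *\<^sub>R y \<in> {x. infdist x S \<le> e}"
      by (auto intro: field_le_epsilon)
  qed
qed

lemma closed_infdist_sublevel: "closed {x. infdist x S \<le> e}"
  by (intro closed_Collect_le continuous_intros)

context
  fixes \<mu> :: "'a::metric_space set \<Rightarrow> 'v::real_normed_vector"
  assumes lc: "locally compact (UNIV :: 'a set)" and sep: "separable_space TYPE('a)"
    and fd: "finite_dim_space TYPE('v)" and \<mu>: "borel_vector_measure \<mu>"
begin

lemma vm_partition_approx:
  assumes A: "\<And>i. i < (m::nat) \<Longrightarrow> A i \<in> sets borel" "disjoint_family_on A {..<m}" and e: "e > 0"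
  obtains \<phi> where "\<And>i. i < m \<Longrightarrow> \<phi> i \<in> Cc" "\<And>i x. i < m \<Longrightarrow> 0 \<le> \<phi> i x" "\<And>x. (\<Sum>i<m. \<phi> i x) \<le> 1"
    "\<And>i. i < m \<Longrightarrow> norm (vm_integral \<mu> (\<phi> i) - \<mu> (A i)) < e"
proof -
  obtain \<tau> c where \<tau>: "finite_measure \<tau>" "sets \<tau> = sets borel" "c > 0"
    "\<And>f. f \<in> bounded_borel \<Longrightarrow> norm (vm_integral \<mu> f) \<le> c * (\<integral>x. \<bar>f x\<bar> \<partial>\<tau>)"
    by (rule vm_integral_dominated[OF fd \<mu>]) blast
  have "e / c > 0" using e \<tau>(3) by simp
  obtain \<phi> where \<phi>: "\<And>i. i < m \<Longrightarrow> \<phi> i \<in> Cc" "\<And>i x. i < m \<Longrightarrow> 0 \<le> \<phi> i x" "\<And>x. (\<Sum>i<m. \<phi> i x) \<le> 1"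
    "\<And>i. i < m \<Longrightarrow> (\<integral>x. \<bar>\<phi> i x - indicator (A i) x\<bar> \<partial>\<tau>) < e / c"
    by (rule Cc_partition_approx[OF \<tau>(1,2) lc sep A \<open>e / c > 0\<close>]) blast+
  note J = represents_vm_integral[OF fd \<mu>]
  have "norm (vm_integral \<mu> (\<phi> i) - \<mu> (A i)) < e" if i: "i < m" for i
  proof -
    have bb: "\<phi> i \<in> bounded_borel" "indicator (A i) \<in> bounded_borel"
      using Cc_bounded_borel[OF \<phi>(1)[OF i]] bounded_borel_indicator[OF A(1)[OF i]] .
    have "vm_integral \<mu> (\<phi> i) - \<mu> (A i) = vm_integral \<mu> (\<lambda>x. \<phi> i x - indicator (A i) x)"
      by (simp add: represents_diff[OF J bb] represents_indicator[OF J A(1)[OF i]])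
    also have "norm \<dots> \<le> c * (\<integral>x. \<bar>\<phi> i x - indicator (A i) x\<bar> \<partial>\<tau>)"
      by (intro \<tau>(4) bounded_borel_diff bb)
    also have "\<dots> < c * (e / c)" using \<phi>(4)[OF i] \<tau>(3) by (intro mult_strict_left_mono)
    finally show ?thesis using \<tau>(3) by simp
  qed
  with \<phi>(1-3) show ?thesis by (rule that)
qed

lemma total_variation_Cc_approx:
  assumes "y < total_variation \<mu> UNIV"
  obtains m :: nat and \<phi> where "\<And>i. i < m \<Longrightarrow> \<phi> i \<in> Cc" "\<And>i x. i < m \<Longrightarrow> 0 \<le> \<phi> i x"
    "\<And>x. (\<Sum>i<m. \<phi> i x) \<le> 1" "y < (\<Sum>i<m. norm (vm_integral \<mu> (\<phi> i)))"
proof -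
  obtain m :: nat and A where A: "\<And>i. i < m \<Longrightarrow> A i \<in> sets borel" "disjoint_family_on A {..<m}"
    "y < (\<Sum>i<m. norm (\<mu> (A i)))"
    by (rule total_variation_approx[OF assms]) blast
  \<comment> \<open>With the gap divided by \<open>Suc m\<close>, the \<open>m\<close> approximation
    errors together leave at least \<open>e\<close> of it, which keeps the inequality
    strict.\<close>
  define e where "e = ((\<Sum>i<m. norm (\<mu> (A i))) - y) / real (Suc m)"
  have e: "e > 0" using A(3) by (simp add: e_def)
  obtain \<phi> where \<phi>: "\<And>i. i < m \<Longrightarrow> \<phi> i \<in> Cc" "\<And>i x. i < m \<Longrightarrow> 0 \<le> \<phi> i x" "\<And>x. (\<Sum>i<m. \<phi> i x) \<le> 1"
    "\<And>i. i < m \<Longrightarrow> norm (vm_integral \<mu> (\<phi> i) - \<mu> (A i)) < e"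
    by (rule vm_partition_approx[OF A(1,2) e]) blast+
  have "norm (\<mu> (A i)) - e \<le> norm (vm_integral \<mu> (\<phi> i))" if "i < m" for i
    using \<phi>(4)[OF that] norm_triangle_ineq2[of "\<mu> (A i)" "vm_integral \<mu> (\<phi> i)"]
    by (simp add: norm_minus_commute)
  then have "(\<Sum>i<m. norm (\<mu> (A i)) - e) \<le> (\<Sum>i<m. norm (vm_integral \<mu> (\<phi> i)))"
    by (intro sum_mono) simp
  moreover have "(\<Sum>i<m. norm (\<mu> (A i)) - e) = (\<Sum>i<m. norm (\<mu> (A i))) - real m * e"
    by (simp add: sum_subtractf)
  moreover have "real (Suc m) * e = (\<Sum>i<m. norm (\<mu> (A i))) - y"
    by (simp add: e_def del: of_nat_Suc)
  then have "real m * e + e = (\<Sum>i<m. norm (\<mu> (A i))) - y" by (simp add: algebra_simps)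
  ultimately have "y < (\<Sum>i<m. norm (vm_integral \<mu> (\<phi> i)))" using e by linarith
  with \<phi>(1-3) show ?thesis by (rule that)
qed

lemma vm_range_subset_closure_Cc:
  "vm_range \<mu> \<subseteq> closure {vm_integral \<mu> \<phi> | \<phi>. \<phi> \<in> Cc \<and> (\<forall>x. 0 \<le> \<phi> x \<and> \<phi> x \<le> 1)}"
  (is "_ \<subseteq> closure ?S")
proof (rule vm_range_least)
  note J = represents_vm_integral[OF fd \<mu>]
  have "convex ?S"
  proof (rule convexI)
    fix p q and u v :: real assume "p \<in> ?S" "q \<in> ?S" and uv: "0 \<le> u" "0 \<le> v" "u + v = 1"
    then obtain \<phi> \<psi> where \<phi>: "p = vm_integral \<mu> \<phi>" "\<phi> \<in> Cc" "\<And>x. 0 \<le> \<phi> x \<and> \<phi> x \<le> 1"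
      and \<psi>: "q = vm_integral \<mu> \<psi>" "\<psi> \<in> Cc" "\<And>x. 0 \<le> \<psi> x \<and> \<psi> x \<le> 1"
      by auto
    have "vm_integral \<mu> (\<lambda>x. u * \<phi> x + v * \<psi> x) = u *\<^sub>R p + v *\<^sub>R q"
      unfolding \<phi>(1) \<psi>(1)
      using Cc_bounded_borel[OF \<phi>(2)] Cc_bounded_borel[OF \<psi>(2)]
      by (subst represents_add[OF J bounded_borel_cmult bounded_borel_cmult])
        (simp_all add: represents_cmult[OF J])
    moreover have "(\<lambda>x. u * \<phi> x + v * \<psi> x) \<in> Cc" by (intro Cc_add Cc_cmult \<phi> \<psi>)
    moreover have "0 \<le> u * \<phi> x + v * \<psi> x \<and> u * \<phi> x + v * \<psi> x \<le> 1" for x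
      using convex_bound_le[of "\<phi> x" 1 "\<psi> x" u v] \<phi>(3)[of x] \<psi>(3)[of x] uv by simp
    ultimately show "u *\<^sub>R p + v *\<^sub>R q \<in> ?S"
      by (intro CollectI exI[of _ "\<lambda>x. u * \<phi> x + v * \<psi> x"]) simp
  qed
  then show "convex (closure ?S)" by (rule convex_closure)
  show "closed (closure ?S)" by simp
  fix E :: "'a set" assume E: "E \<in> sets borel"
  show "\<mu> E \<in> closure ?S"
    unfolding closure_approachable
  proof (intro allI impI)
    fix e :: real assume "e > 0"
    \<comment> \<open>A partition with the single member \<open>E\<close> produces one function with
      values in \<open>[0,1]\<close>.\<close>
    obtain \<phi> where \<phi>: "\<And>i. i < (1::nat) \<Longrightarrow> \<phi> i \<in> Cc" "\<And>i x. i < (1::nat) \<Longrightarrow> 0 \<le> \<phi> i x"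
      "\<And>x. (\<Sum>i<(1::nat). \<phi> i x) \<le> 1" "\<And>i. i < (1::nat) \<Longrightarrow> norm (vm_integral \<mu> (\<phi> i) - \<mu> E) < e"
      by (rule vm_partition_approx[of 1 "\<lambda>_. E" e])
        (use E \<open>e > 0\<close> in \<open>auto simp: disjoint_family_on_def\<close>)
    then show "\<exists>y\<in>?S. dist y (\<mu> E) < e"
      by (intro bexI[of _ "vm_integral \<mu> (\<phi> 0)"]) (auto simp: dist_norm)
  qed
qed

end

text \<open>The slack \<open>e\<close> is spent \<open>C\<close> times on the deficits of the
  splittings and once on the part of \<open>E\<close> not covered by the \<open>\<phi> i\<close>,
  whence the factor \<open>C + 1\<close>. The bound does not depend on \<open>E\<close> or on
  \<open>m\<close>.\<close>

lemma vm_close_to_combination: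
  fixes \<mu> :: "'a::metric_space set \<Rightarrow> 'v::real_normed_vector"
  assumes fd: "finite_dim_space TYPE('v)" and \<mu>: "borel_vector_measure \<mu>" and E: "E \<in> sets borel"
    and \<phi>: "\<And>i. i < (m::nat) \<Longrightarrow> \<phi> i \<in> bounded_borel" "\<And>i x. i < m \<Longrightarrow> 0 \<le> \<phi> i x" "\<And>x. (\<Sum>i<m. \<phi> i x) \<le> 1"
    and C: "C \<ge> 0" "\<forall>v w::'v. \<exists>t\<in>{0..1}. norm (v - t *\<^sub>R (v + w)) \<le>
      \<delta> * (norm v + norm w) + C * (norm v + norm w - norm (v + w))" and \<delta>: "\<delta> \<ge> 0"
    and e: "total_variation \<mu> UNIV - (\<Sum>i<m. norm (vm_integral \<mu> (\<phi> i))) \<le> e"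
  obtains t where "\<And>i. t i \<in> {0..1}"
    "norm (\<mu> E - (\<Sum>i<m. t i *\<^sub>R vm_integral \<mu> (\<phi> i))) \<le> \<delta> * total_variation \<mu> UNIV + (C + 1) * e"
proof -
  note J = represents_vm_integral[OF fd \<mu>]
  let ?J = "vm_integral \<mu>" and ?V = "total_variation \<mu> UNIV"
  have Ec: "UNIV - E \<in> sets borel" using E by auto
  note ind = bounded_borel_indicator[OF E] bounded_borel_indicator[OF Ec]
  define f g where "f i x = \<phi> i x * indicator E x" and "g i x = \<phi> i x * indicator (UNIV - E) x" for i x
  \<comment> \<open>On \<open>E\<close> this is the remainder
    \<open>1 - (\<Sum>i<m. \<phi> i x)\<close>, and 0 elsewhere; it accounts for the mass in
    \<open>E\<close> that the test functions miss.\<close>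
  define h where "h x = indicator E x - (\<Sum>i<m. f i x)" for x
  have fg: "f i \<in> bounded_borel" "g i \<in> bounded_borel" if "i < m" for i
    unfolding f_def[abs_def] g_def[abs_def] using \<phi>(1)[OF that] ind by (auto intro: bounded_borel_mult)
  have h: "h \<in> bounded_borel"
    unfolding h_def[abs_def] by (intro bounded_borel_diff ind bounded_borel_sum fg) auto
  have split: "?J (f i) + ?J (g i) = ?J (\<phi> i)" if "i < m" for i
  proof -
    have "(\<lambda>x. f i x + g i x) = \<phi> i" by (auto simp: f_def g_def indicator_def)
    then show ?thesis using represents_add[OF J fg[OF that]] by simp
  qed
  have "?J h = ?J (indicator E) - ?J (\<lambda>x. \<Sum>i<m. f i x)"
    unfolding h_def[abs_def] by (intro represents_diff[OF J] ind bounded_borel_sum fg) auto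
  also have "\<dots> = \<mu> E - (\<Sum>i<m. ?J (f i))"
    using represents_indicator[OF J E] represents_sum[OF J, of "{..<m}" f] fg by simp
  finally have Jh: "\<mu> E = (\<Sum>i<m. ?J (f i)) + ?J h" by simp
  have fsum: "(\<Sum>i<m. f i x) = (\<Sum>i<m. \<phi> i x) * indicator E x"
    "(\<Sum>i<m. g i x) = (\<Sum>i<m. \<phi> i x) * indicator (UNIV - E) x" for x
    by (simp_all add: f_def g_def sum_distrib_right)
  \<comment> \<open>The \<open>2m + 1\<close> functions \<open>f i\<close>, \<open>g i\<close>, \<open>h\<close> are nonnegative with sum at most 1, so their
    integrals have norms summing to at most the total variation.\<close>
  define \<psi> where "\<psi> k = (if k < m then f k else if k < m + m then g (k - m) else h)" for k
  have sum_split: "(\<Sum>k<Suc (m + m). F (\<psi> k)) = (\<Sum>i<m. F (f i)) + (\<Sum>i<m. F (g i)) + F h"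
    for F :: "('a \<Rightarrow> real) \<Rightarrow> real"
  proof -
    have "(\<Sum>k<m + n. F (\<psi> k)) = (\<Sum>k<m. F (\<psi> k)) + (\<Sum>k<n. F (\<psi> (m + k)))" for n
      by (induction n) simp_all
    then show ?thesis by (simp add: \<psi>_def)
  qed
  have "(\<Sum>k<Suc (m + m). norm (?J (\<psi> k))) \<le> ?V"
  proof (rule represents_sum_norm_le[OF J])
    show "\<psi> k \<in> bounded_borel" if "k < Suc (m + m)" for k
      using fg h by (auto simp: \<psi>_def)
    show "0 \<le> \<psi> k x" if "k < Suc (m + m)" for k x
    proof -
      have "0 \<le> h x" using \<phi>(3)[of x] by (simp add: h_def fsum indicator_def)
      then show ?thesis using \<phi>(2) by (auto simp: \<psi>_def f_def g_def)
    qed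
    show "(\<Sum>k<Suc (m + m). \<psi> k x) \<le> 1" for x
      using sum_split[of "\<lambda>p. p x"] \<phi>(3)[of x] by (simp add: h_def fsum indicator_def)
    show "(\<Sum>k<Suc (m + m). norm (\<mu> (A k))) \<le> ?V"
      if "\<And>k. k < Suc (m + m) \<Longrightarrow> A k \<in> sets borel" "disjoint_family_on A {..<Suc (m + m)}" for A
      using that by (rule total_variation_upper[OF fd \<mu>])
  qed
  then have V: "(\<Sum>i<m. norm (?J (f i))) + (\<Sum>i<m. norm (?J (g i))) + norm (?J h) \<le> ?V"
    using sum_split[of "\<lambda>p. norm (?J p)"] by linarith
  have "\<forall>i. \<exists>t. t \<in> {0..1} \<and> norm (?J (f i) - t *\<^sub>R (?J (f i) + ?J (g i))) \<le>
      \<delta> * (norm (?J (f i)) + norm (?J (g i))) + C * (norm (?J (f i)) + norm (?J (g i)) - norm (?J (f i) + ?J (g i)))"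
    using C(2) by blast
  from choice[OF this] obtain t where t: "\<And>i. t i \<in> {0..1}"
    "\<And>i. norm (?J (f i) - t i *\<^sub>R (?J (f i) + ?J (g i))) \<le>
      \<delta> * (norm (?J (f i)) + norm (?J (g i))) + C * (norm (?J (f i)) + norm (?J (g i)) - norm (?J (f i) + ?J (g i)))"
    by blast
  have ti: "norm (?J (f i) - t i *\<^sub>R ?J (\<phi> i)) \<le>
      \<delta> * (norm (?J (f i)) + norm (?J (g i))) + C * (norm (?J (f i)) + norm (?J (g i)) - norm (?J (\<phi> i)))"
    if "i < m" for i using t(2)[of i] split[OF that] by simp
  let ?F = "\<Sum>i<m. norm (?J (f i))" and ?G = "\<Sum>i<m. norm (?J (g i))" and ?P = "\<Sum>i<m. norm (?J (\<phi> i))"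
  have "\<mu> E - (\<Sum>i<m. t i *\<^sub>R ?J (\<phi> i)) = (\<Sum>i<m. ?J (f i) - t i *\<^sub>R ?J (\<phi> i)) + ?J h"
    by (simp add: Jh sum_subtractf)
  then have "norm (\<mu> E - (\<Sum>i<m. t i *\<^sub>R ?J (\<phi> i))) \<le> (\<Sum>i<m. norm (?J (f i) - t i *\<^sub>R ?J (\<phi> i))) + norm (?J h)"
    using norm_triangle_ineq[of "\<Sum>i<m. ?J (f i) - t i *\<^sub>R ?J (\<phi> i)" "?J h"]
      norm_sum[of "\<lambda>i. ?J (f i) - t i *\<^sub>R ?J (\<phi> i)" "{..<m}"] by simp
  also have "(\<Sum>i<m. norm (?J (f i) - t i *\<^sub>R ?J (\<phi> i))) \<le>
      (\<Sum>i<m. \<delta> * (norm (?J (f i)) + norm (?J (g i))) + C * (norm (?J (f i)) + norm (?J (g i)) - norm (?J (\<phi> i))))"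
    by (intro sum_mono ti) simp
  also have "\<dots> = \<delta> * (?F + ?G) + C * (?F + ?G - ?P)"
    by (simp add: sum.distrib sum_subtractf flip: sum_distrib_left)
  finally have main: "norm (\<mu> E - (\<Sum>i<m. t i *\<^sub>R ?J (\<phi> i))) \<le> \<delta> * (?F + ?G) + C * (?F + ?G - ?P) + norm (?J h)"
    by simp
  have "norm (?J (\<phi> i)) \<le> norm (?J (f i)) + norm (?J (g i))" if "i < m" for i
    using split[OF that] norm_triangle_ineq by metis
  \<comment> \<open>Since \<open>?P\<close> is within \<open>e\<close> of \<open>?V\<close> and
    \<open>?F + ?G + norm (?J h)\<close> is at most \<open>?V\<close>, this leaves at most
    \<open>e\<close> for the remainder and at most \<open>e\<close> for the sum of all
    deficits.\<close>
  then have "?P \<le> ?F + ?G" unfolding sum.distrib[symmetric] by (intro sum_mono) simp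
  then have "norm (?J h) \<le> e" using V e by linarith
  moreover have "\<delta> * (?F + ?G) \<le> \<delta> * ?V" using V \<delta> by (intro mult_left_mono) (smt (verit) norm_ge_zero)+
  moreover have "C * (?F + ?G - ?P) \<le> C * e"
    using V e C(1) by (intro mult_left_mono) (smt (verit) norm_ge_zero)+
  ultimately have "norm (\<mu> E - (\<Sum>i<m. t i *\<^sub>R ?J (\<phi> i))) \<le> \<delta> * ?V + (C + 1) * e"
    using main by (simp add: algebra_simps)
  with t(1) show ?thesis by (rule that)
qed

section \<open>Convergence of the ranges\<close>

lemma eventually_vm_range_near:
  fixes \<mu>s :: "nat \<Rightarrow> 'a::metric_space set \<Rightarrow> 'v::real_normed_vector" and \<mu> :: "'a set \<Rightarrow> 'v"
  assumes lc: "locally compact (UNIV :: 'a set)" and sep: "separable_space TYPE('a)"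
    and fd: "finite_dim_space TYPE('v)" and sc: "strictly_convex_norm TYPE('v)"
    and \<mu>s: "\<And>n. borel_vector_measure (\<mu>s n)" and \<mu>: "borel_vector_measure \<mu>"
    and conv: "widely_converges \<mu>s \<mu>"
    and tv: "(\<lambda>n. total_variation (\<mu>s n) UNIV) \<longlonglongrightarrow> total_variation \<mu> UNIV"
    and e: "e > 0"
  shows "\<forall>\<^sub>F n in sequentially. \<forall>a\<in>vm_range (\<mu>s n). infdist a (vm_range \<mu>) \<le> e"
proof -
  let ?M = "total_variation \<mu> UNIV" and ?J = "vm_integral \<mu>" and ?Jn = "\<lambda>n. vm_integral (\<mu>s n)"
  have M0: "?M \<ge> 0" using order_trans[OF norm_ge_zero norm_vm_le_total_variation[OF fd \<mu>, of "{}"]] by simp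
  \<comment> \<open>Eventually the total variation of \<open>\<mu>s n\<close> is at most
    \<open>?M + 1\<close>, so the \<open>\<delta>\<close> term contributes at most
    \<open>e / 4\<close>.\<close>
  define \<delta> where "\<delta> = e / (4 * (?M + 1))"
  have \<delta>: "\<delta> > 0" using e M0 by (simp add: \<delta>_def)
  have "?M + 1 \<noteq> 0" using M0 by simp
  then have \<delta>M: "\<delta> * (?M + 1) = e / 4" by (simp add: \<delta>_def field_simps)
  obtain C where C: "C \<ge> 0" "\<forall>v w::'v. \<exists>t\<in>{0..1}. norm (v - t *\<^sub>R (v + w)) \<le>
      \<delta> * (norm v + norm w) + C * (norm v + norm w - norm (v + w))"
    using norm_deficit_alignment[OF fd sc \<delta>] by blast
  \<comment> \<open>The remaining errors add up to \<open>(3 * C + 4) * \<epsilon>\<close>, at most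
    \<open>e / 2\<close>; the cap at 1 justifies the bound \<open>?M + 1\<close> on the
    variations.\<close>
  define \<epsilon> where "\<epsilon> = min 1 (e / (2 * (3 * C + 4)))"
  have \<epsilon>: "\<epsilon> > 0" "\<epsilon> \<le> 1" using e C(1) by (auto simp: \<epsilon>_def)
  have "\<epsilon> \<le> e / (2 * (3 * C + 4))" by (simp add: \<epsilon>_def)
  then have \<epsilon>C: "(C + 1) * (3 * \<epsilon>) + \<epsilon> \<le> e / 2" using C(1) by (simp add: field_simps)
  obtain m :: nat and \<phi> where \<phi>: "\<And>i. i < m \<Longrightarrow> \<phi> i \<in> Cc" "\<And>i x. i < m \<Longrightarrow> 0 \<le> \<phi> i x"
    "\<And>x. (\<Sum>i<m. \<phi> i x) \<le> 1" "?M - \<epsilon> < (\<Sum>i<m. norm (?J (\<phi> i)))"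
    by (rule total_variation_Cc_approx[OF lc sep fd \<mu>, of "?M - \<epsilon>"]) (use \<epsilon> in auto)
  have \<phi>b: "\<phi> i \<in> bounded_borel" if "i < m" for i using \<phi>(1)[OF that] by (rule Cc_bounded_borel)
  have "(\<lambda>n. \<Sum>i<m. norm (?Jn n (\<phi> i) - ?J (\<phi> i))) \<longlonglongrightarrow> (\<Sum>i<m. 0)"
  proof (rule tendsto_sum)
    fix i assume "i \<in> {..<m}"
    then have "(\<lambda>n. ?Jn n (\<phi> i)) \<longlonglongrightarrow> ?J (\<phi> i)"
      using conv \<phi>(1) by (auto simp: widely_converges_def)
    then show "(\<lambda>n. norm (?Jn n (\<phi> i) - ?J (\<phi> i))) \<longlonglongrightarrow> 0"
      using LIM_zero tendsto_norm_zero by blast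
  qed
  then have ev1: "\<forall>\<^sub>F n in sequentially. (\<Sum>i<m. norm (?Jn n (\<phi> i) - ?J (\<phi> i))) < \<epsilon>"
    using \<epsilon> by (intro order_tendstoD) simp_all
  have ev2: "\<forall>\<^sub>F n in sequentially. total_variation (\<mu>s n) UNIV < ?M + \<epsilon>"
    using \<epsilon> by (intro order_tendstoD[OF tv]) simp
  from ev1 ev2 show ?thesis
  proof eventually_elim
    case (elim n)
    let ?d = "\<lambda>i. norm (?Jn n (\<phi> i) - ?J (\<phi> i))"
    have "norm (?J (\<phi> i)) - ?d i \<le> norm (?Jn n (\<phi> i))" for i
      using norm_triangle_ineq2[of "?J (\<phi> i)" "?Jn n (\<phi> i)"] by (simp add: norm_minus_commute)
    then have "(\<Sum>i<m. norm (?J (\<phi> i))) - (\<Sum>i<m. ?d i) \<le> (\<Sum>i<m. norm (?Jn n (\<phi> i)))"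
      unfolding sum_subtractf[symmetric] by (intro sum_mono)
    \<comment> \<open>One \<open>\<epsilon>\<close> each comes from the choice of the test
      functions, from the convergence of their integrals and from the convergence of the total
      variations.\<close>
    then have def: "total_variation (\<mu>s n) UNIV - (\<Sum>i<m. norm (?Jn n (\<phi> i))) \<le> 3 * \<epsilon>"
      using elim \<phi>(4) by linarith
    have "vm_range (\<mu>s n) \<subseteq> {x. infdist x (vm_range \<mu>) \<le> e}"
    proof (rule vm_range_least[OF convex_infdist_sublevel[OF convex_vm_range] closed_infdist_sublevel])
      fix E :: "'a set" assume E: "E \<in> sets borel"
      obtain t where t: "\<And>i. t i \<in> {0..1}"
        "norm (\<mu>s n E - (\<Sum>i<m. t i *\<^sub>R ?Jn n (\<phi> i))) \<le> \<delta> * total_variation (\<mu>s n) UNIV + (C + 1) * (3 * \<epsilon>)"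
        by (rule vm_close_to_combination[OF fd \<mu>s E \<phi>b \<phi>(2,3) C less_imp_le[OF \<delta>] def]) blast+
      have t': "0 \<le> t i" "t i \<le> 1" for i using t(1)[of i] by auto
      have "(\<Sum>i<m. t i *\<^sub>R ?J (\<phi> i)) = ?J (\<lambda>x. \<Sum>i<m. t i * \<phi> i x)"
        using represents_sum[OF represents_vm_integral[OF fd \<mu>], of "{..<m}" "\<lambda>i x. t i * \<phi> i x"]
          represents_cmult[OF represents_vm_integral[OF fd \<mu>]] \<phi>b by (simp add: bounded_borel_cmult)
      also have "\<dots> \<in> vm_range \<mu>"
      proof (rule represents_in_vm_range[OF represents_vm_integral[OF fd \<mu>]])
        show "(\<lambda>x. \<Sum>i<m. t i * \<phi> i x) \<in> bounded_borel"
          by (intro bounded_borel_sum bounded_borel_cmult \<phi>b) simp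
        fix x
        show "0 \<le> (\<Sum>i<m. t i * \<phi> i x)" using t' \<phi>(2) by (intro sum_nonneg) simp
        have "(\<Sum>i<m. t i * \<phi> i x) \<le> (\<Sum>i<m. \<phi> i x)"
          using t' \<phi>(2) by (intro sum_mono mult_left_le_one_le) auto
        then show "(\<Sum>i<m. t i * \<phi> i x) \<le> 1" using \<phi>(3)[of x] by linarith
      qed
      finally have "infdist (\<mu>s n E) (vm_range \<mu>) \<le> norm (\<mu>s n E - (\<Sum>i<m. t i *\<^sub>R ?J (\<phi> i)))"
        unfolding dist_norm[symmetric] by (rule infdist_le)
      also have "\<dots> \<le> norm (\<mu>s n E - (\<Sum>i<m. t i *\<^sub>R ?Jn n (\<phi> i))) +
          norm ((\<Sum>i<m. t i *\<^sub>R ?Jn n (\<phi> i)) - (\<Sum>i<m. t i *\<^sub>R ?J (\<phi> i)))"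
        using norm_triangle_ineq[of "\<mu>s n E - (\<Sum>i<m. t i *\<^sub>R ?Jn n (\<phi> i))"
            "(\<Sum>i<m. t i *\<^sub>R ?Jn n (\<phi> i)) - (\<Sum>i<m. t i *\<^sub>R ?J (\<phi> i))"] by simp
      also have "norm ((\<Sum>i<m. t i *\<^sub>R ?Jn n (\<phi> i)) - (\<Sum>i<m. t i *\<^sub>R ?J (\<phi> i))) \<le> (\<Sum>i<m. ?d i)"
        unfolding sum_subtractf[symmetric] scaleR_diff_right[symmetric]
        using t' by (intro sum_norm_le) (simp add: mult_left_le_one_le)
      also have "norm (\<mu>s n E - (\<Sum>i<m. t i *\<^sub>R ?Jn n (\<phi> i))) + (\<Sum>i<m. ?d i)
          \<le> (\<delta> * (?M + 1) + (C + 1) * (3 * \<epsilon>)) + \<epsilon>"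
      proof (rule add_mono[OF order_trans[OF t(2)]])
        show "\<delta> * total_variation (\<mu>s n) UNIV + (C + 1) * (3 * \<epsilon>) \<le> \<delta> * (?M + 1) + (C + 1) * (3 * \<epsilon>)"
          using elim \<epsilon> \<delta> by (intro add_right_mono mult_left_mono) auto
      qed (use elim in simp)
      also have "\<dots> \<le> e" using \<delta>M \<epsilon>C e by linarith
      finally show "\<mu>s n E \<in> {x. infdist x (vm_range \<mu>) \<le> e}" by simp
    qed
    then show ?case by blast
  qed
qed

text \<open>Wide convergence is a statement about one test function at a time. Compactness of the
  limit range reduces the uniform claim to finitely many test functions.\<close>

lemma eventually_limit_range_near:
  fixes \<mu>s :: "nat \<Rightarrow> 'a::metric_space set \<Rightarrow> 'v::real_normed_vector" and \<mu> :: "'a set \<Rightarrow> 'v"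
  assumes lc: "locally compact (UNIV :: 'a set)" and sep: "separable_space TYPE('a)"
    and fd: "finite_dim_space TYPE('v)"
    and \<mu>s: "\<And>n. borel_vector_measure (\<mu>s n)" and \<mu>: "borel_vector_measure \<mu>"
    and conv: "widely_converges \<mu>s \<mu>" and e: "e > 0"
  shows "\<forall>\<^sub>F n in sequentially. \<forall>b\<in>vm_range \<mu>. infdist b (vm_range (\<mu>s n)) \<le> e"
proof -
  let ?\<Phi> = "{\<phi> \<in> Cc. \<forall>x::'a. 0 \<le> \<phi> x \<and> \<phi> x \<le> (1::real)}"
  have comp: "compact (vm_range \<mu>)"
    by (rule finite_dim_compact[OF fd bounded_vm_range[OF fd \<mu>] closed_vm_range])
  have cover: "vm_range \<mu> \<subseteq> (\<Union>\<phi>\<in>?\<Phi>. ball (vm_integral \<mu> \<phi>) (e / 2))"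
  proof
    fix b assume "b \<in> vm_range \<mu>"
    then have "b \<in> closure {vm_integral \<mu> \<phi> | \<phi>. \<phi> \<in> Cc \<and> (\<forall>x. 0 \<le> \<phi> x \<and> \<phi> x \<le> 1)}"
      using vm_range_subset_closure_Cc[OF lc sep fd \<mu>] by blast
    then obtain y where "y \<in> {vm_integral \<mu> \<phi> | \<phi>. \<phi> \<in> Cc \<and> (\<forall>x. 0 \<le> \<phi> x \<and> \<phi> x \<le> 1)}" "dist y b < e / 2"
      using half_gt_zero[OF e] unfolding closure_approachable by blast
    then show "b \<in> (\<Union>\<phi>\<in>?\<Phi>. ball (vm_integral \<mu> \<phi>) (e / 2))" by auto
  qed
  obtain F where F: "F \<subseteq> ?\<Phi>" "finite F"
    "vm_range \<mu> \<subseteq> (\<Union>\<phi>\<in>F. ball (vm_integral \<mu> \<phi>) (e / 2))"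
    by (rule compactE_image[OF comp _ cover]) auto
  have "\<forall>\<^sub>F n in sequentially. dist (vm_integral (\<mu>s n) \<phi>) (vm_integral \<mu> \<phi>) < e / 2" if "\<phi> \<in> F" for \<phi>
    using conv F(1) that e unfolding widely_converges_def by (intro tendstoD) auto
  then have "\<forall>\<^sub>F n in sequentially. \<forall>\<phi>\<in>F. dist (vm_integral (\<mu>s n) \<phi>) (vm_integral \<mu> \<phi>) < e / 2"
    using F(2) by (intro eventually_ball_finite) auto
  then show ?thesis
  proof eventually_elim
    case (elim n)
    show ?case
    proof
      fix b assume "b \<in> vm_range \<mu>"
      then obtain \<phi> where \<phi>: "\<phi> \<in> F" "dist (vm_integral \<mu> \<phi>) b < e / 2" using F(3) by auto
      have "vm_integral (\<mu>s n) \<phi> \<in> vm_range (\<mu>s n)"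
        using F(1) \<phi>(1) by (intro represents_in_vm_range[OF represents_vm_integral[OF fd \<mu>s]] Cc_bounded_borel) auto
      then have "infdist b (vm_range (\<mu>s n)) \<le> dist b (vm_integral (\<mu>s n) \<phi>)" by (rule infdist_le)
      also have "\<dots> \<le> dist b (vm_integral \<mu> \<phi>) + dist (vm_integral \<mu> \<phi>) (vm_integral (\<mu>s n) \<phi>)"
        by (rule dist_triangle)
      also have "\<dots> \<le> e" using elim \<phi> by (auto simp: dist_commute intro: less_imp_le)
      finally show "infdist b (vm_range (\<mu>s n)) \<le> e" .
    qed
  qed
qed

theorem theorem3p1:
  fixes \<mu>s :: "nat \<Rightarrow> 'a::metric_space set \<Rightarrow> 'v::real_normed_vector"
    and \<mu> :: "'a set \<Rightarrow> 'v"
  assumes "locally compact (UNIV :: 'a set)"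
    and "separable_space TYPE('a)"
    and "finite_dim_space TYPE('v)"
    and "strictly_convex_norm TYPE('v)"
    and "\<And>n. borel_vector_measure (\<mu>s n)"
    and "borel_vector_measure \<mu>"
    and "widely_converges \<mu>s \<mu>"
    and "(\<lambda>n. total_variation (\<mu>s n) UNIV) \<longlonglongrightarrow> total_variation \<mu> UNIV"
  shows "(\<lambda>n. hausdorff_distance (vm_range (\<mu>s n)) (vm_range \<mu>)) \<longlonglongrightarrow> 0"
proof (rule tendstoI)
  fix e :: real assume "e > 0"
  \<comment> \<open>Only non-strict bounds by \<open>e / 2\<close> come out of the two inclusions;
    halving restores the strict inequality.\<close>
  then have e: "e / 2 > 0" by simp
  from eventually_vm_range_near[OF assms e]
    eventually_limit_range_near[OF assms(1-3,5-7) e]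
  show "\<forall>\<^sub>F n in sequentially. dist (hausdorff_distance (vm_range (\<mu>s n)) (vm_range \<mu>)) 0 < e"
  proof eventually_elim
    case (elim n)
    have "hausdorff_distance (vm_range (\<mu>s n)) (vm_range \<mu>) \<le> e / 2"
      using elim by (intro hausdorff_distance_le vm_range_nonempty) auto
    moreover have "0 \<le> hausdorff_distance (vm_range (\<mu>s n)) (vm_range \<mu>)"
      by (intro hausdorff_distance_nonneg bounded_vm_range vm_range_nonempty assms)
    ultimately show ?case using \<open>e > 0\<close> by simp
  qed
qed

end
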